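(* The following statements are equivalent: (i) $X$ has an indefinite Wiener integral; (ii) the Cameron-Martin space of $X$ is closed against truncation in time, i.e., for every $\underline h\in CM_X$ and $r\in[0,T]$, the mapping $\underline h^r:t\mapsto\underline h(t\wedge r)$ satisfies $\underline h^r\in CM_X$.
   Context: Let $T>0$ and let $X=(X_t)_{t\in[0,T]}$ be a measurable centered Gaussian process with $X_0=0$ on a complete probability space $(\Omega,\mathcal F,P)$, with covariance $R(t,s)=\mathbb E[X_tX_s]$. Let $\mathcal F^X_T=\sigma(X_s:0\le s\le T)$ and $L^2_X=L^2(\Omega,\mathcal F^X_T,P)$. The first chaos $H_X$ is the closure in $L^2_X$ of $\mathrm{span}\{X_s:0\le s\le T\}$. The space of deterministic integrands $\mathfrak H_X$ is the Hilbert space obtained as closure (completion) of the linear span of the indicator functions $\mathbf 1_{(0,t]}$, $t\in[0,T]$, with inner product $\langle \mathbf 1_{(0,t]},\mathbf 1_{(0,s]}\rangle_{\mathfrak H_X}=R(t,s)$. For $h\in H_X$ put $\underline h(t)=\mathbb E[X_th]$, $t\in[0,T]$; the Cameron-Martin space $CM_X$ is the set of all functions $\underline h$, $h\in H_X$, with inner product $\langle\underline h_1,\underline h_2\rangle_{CM_X}=\mathbb E[h_1h_2]$. $X$ has an indefinite Wiener integral if for every $r\in[0,T]$ there is a continuous linear operator $\mathbb I_r:\mathfrak H_X\to\mathfrak H_X$ with $\mathbb I_r(\mathbf 1_{(0,t]})=\mathbf 1_{(0,t\wedge r]}$ for all $t\in[0,T]$. *)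

theory Defs
  imports "HOL-Probability.Probability"
begin

section \<open>The process\<close>

text \<open>Constants count as (degenerate) Gaussian variables.\<close>

definition gaussian_rv :: "'a measure \<Rightarrow> ('a \<Rightarrow> real) \<Rightarrow> bool" where
  "gaussian_rv M Y \<longleftrightarrow> Y \<in> borel_measurable M \<and>
     ((\<exists>\<mu>. AE \<omega> in M. Y \<omega> = \<mu>) \<or>
      (\<exists>\<mu> \<sigma>. \<sigma> > 0 \<and> distributed M lborel Y (normal_density \<mu> \<sigma>)))"

text \<open>The process is a family indexed by all reals of which only the members with index in
  \<open>{0..T}\<close> matter. Joint Gaussianity is expressed by Gaussianity of all finite linear
  combinations, and \<open>X\<^sub>0 = 0\<close> is equality of random variables, that is, almost surely.\<close>

locale centered_gaussian_process = prob_space M + complete_measure M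
  for M :: "'a measure" +
  fixes T :: real and X :: "real \<Rightarrow> 'a \<Rightarrow> real"
  assumes T_pos: "T > 0"
    and jointly_measurable:
      "(\<lambda>(t, \<omega>). X t \<omega>) \<in> borel_measurable (restrict_space borel {0..T} \<Otimes>\<^sub>M M)"
    and gaussian: "\<And>S c. finite S \<Longrightarrow> S \<subseteq> {0..T} \<Longrightarrow> gaussian_rv M (\<lambda>\<omega>. \<Sum>t\<in>S. c t * X t \<omega>)"
    and centered: "\<And>t. t \<in> {0..T} \<Longrightarrow> (\<integral>\<omega>. X t \<omega> \<partial>M) = 0"
    and start_zero: "AE \<omega> in M. X 0 \<omega> = 0"

definition covariance :: "'a measure \<Rightarrow> (real \<Rightarrow> 'a \<Rightarrow> real) \<Rightarrow> real \<Rightarrow> real \<Rightarrow> real" where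
  "covariance M X t s = (\<integral>\<omega>. X t \<omega> * X s \<omega> \<partial>M)"


section \<open>First chaos and Cameron-Martin space\<close>

definition process_sigma :: "'a measure \<Rightarrow> real \<Rightarrow> (real \<Rightarrow> 'a \<Rightarrow> real) \<Rightarrow> 'a measure" where
  "process_sigma M T X =
     sigma (space M) {X s -` B \<inter> space M | s B. s \<in> {0..T} \<and> B \<in> sets borel}"

text \<open>Elements of \<open>L\<^sup>2\<close> are represented by square integrable functions; no quotient by
  almost sure equality is taken.\<close>

definition L2_process :: "'a measure \<Rightarrow> real \<Rightarrow> (real \<Rightarrow> 'a \<Rightarrow> real) \<Rightarrow> ('a \<Rightarrow> real) set" where
  "L2_process M T X =
     {Y. Y \<in> borel_measurable (process_sigma M T X) \<and> integrable M (\<lambda>\<omega>. (Y \<omega>)\<^sup>2)}"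

definition L2_dist :: "'a measure \<Rightarrow> ('a \<Rightarrow> real) \<Rightarrow> ('a \<Rightarrow> real) \<Rightarrow> real" where
  "L2_dist M Y Z = sqrt (\<integral>\<omega>. (Y \<omega> - Z \<omega>)\<^sup>2 \<partial>M)"

definition process_span :: "real \<Rightarrow> (real \<Rightarrow> 'a \<Rightarrow> real) \<Rightarrow> ('a \<Rightarrow> real) set" where
  "process_span T X = {\<lambda>\<omega>. \<Sum>s\<in>S. c s * X s \<omega> | S c. finite S \<and> S \<subseteq> {0..T}}"

definition first_chaos :: "'a measure \<Rightarrow> real \<Rightarrow> (real \<Rightarrow> 'a \<Rightarrow> real) \<Rightarrow> ('a \<Rightarrow> real) set" where
  "first_chaos M T X =
     {h \<in> L2_process M T X. \<forall>e>0. \<exists>g\<in>process_span T X. L2_dist M h g < e}"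

text \<open>Functions on \<open>{0..T}\<close> are represented by extensional functions.\<close>

definition cm_function ::
  "'a measure \<Rightarrow> real \<Rightarrow> (real \<Rightarrow> 'a \<Rightarrow> real) \<Rightarrow> ('a \<Rightarrow> real) \<Rightarrow> real \<Rightarrow> real" where
  "cm_function M T X h = restrict (\<lambda>t. \<integral>\<omega>. X t \<omega> * h \<omega> \<partial>M) {0..T}"

definition cameron_martin ::
  "'a measure \<Rightarrow> real \<Rightarrow> (real \<Rightarrow> 'a \<Rightarrow> real) \<Rightarrow> (real \<Rightarrow> real) set" where
  "cameron_martin M T X = cm_function M T X ` first_chaos M T X"

definition truncate_at :: "real \<Rightarrow> real \<Rightarrow> (real \<Rightarrow> real) \<Rightarrow> real \<Rightarrow> real" where
  "truncate_at T r f = restrict (\<lambda>t. f (min t r)) {0..T}"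

definition closed_under_truncation ::
  "'a measure \<Rightarrow> real \<Rightarrow> (real \<Rightarrow> 'a \<Rightarrow> real) \<Rightarrow> bool" where
  "closed_under_truncation M T X \<longleftrightarrow>
     (\<forall>f\<in>cameron_martin M T X. \<forall>r\<in>{0..T}. truncate_at T r f \<in> cameron_martin M T X)"


section \<open>Step functions\<close>

definition step_comb :: "real set \<Rightarrow> (real \<Rightarrow> real) \<Rightarrow> real \<Rightarrow> real" where
  "step_comb S c = (\<lambda>x. \<Sum>t\<in>S. c t * indicator {0<..t} x)"

definition step_space :: "real \<Rightarrow> (real \<Rightarrow> real) set" where
  "step_space T = {step_comb S c | S c. finite S \<and> S \<subseteq> {0..T}}"

text \<open>The indicators of \<open>(0,t]\<close> with \<open>t > 0\<close> are linearly independent, so a step function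
  has unique coefficients with respect to them; the indicator of \<open>(0,0]\<close> is zero.\<close>

definition step_coeff :: "(real \<Rightarrow> real) \<Rightarrow> real \<Rightarrow> real" where
  "step_coeff f = (THE c. finite {t. c t \<noteq> 0} \<and> {t. c t \<noteq> 0} \<subseteq> {0<..} \<and>
                          f = step_comb {t. c t \<noteq> 0} c)"

text \<open>The bilinear form with \<open>\<langle>1\<^bsub>(0,t]\<^esub>, 1\<^bsub>(0,s]\<^esub>\<rangle> = R t s\<close>; see
  \<open>step_inner_comb\<close> and \<open>step_inner_indicator\<close> below. It is only positive semidefinite in
  general.\<close>

definition step_inner ::
  "(real \<Rightarrow> real \<Rightarrow> real) \<Rightarrow> (real \<Rightarrow> real) \<Rightarrow> (real \<Rightarrow> real) \<Rightarrow> real" where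
  "step_inner R f g =
     (\<Sum>s | step_coeff f s \<noteq> 0. \<Sum>t | step_coeff g t \<noteq> 0. step_coeff f s * step_coeff g t * R s t)"

definition step_norm :: "(real \<Rightarrow> real \<Rightarrow> real) \<Rightarrow> (real \<Rightarrow> real) \<Rightarrow> real" where
  "step_norm R f = sqrt (step_inner R f f)"

lemma step_comb_eq_zero:
  assumes "finite S" "S \<subseteq> {0<..}" "step_comb S e = (\<lambda>x. 0)" "t \<in> S"
  shows "e t = 0"
proof (rule ccontr)
  assume "e t \<noteq> 0"
  define N where "N = {s\<in>S. e s \<noteq> 0}"
  have fin: "finite N" and "N \<noteq> {}"
    using assms \<open>e t \<noteq> 0\<close> by (auto simp: N_def)
  define u where "u = Max N"
  have uN: "u \<in> N" and le: "\<And>s. s \<in> N \<Longrightarrow> s \<le> u"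
    using fin \<open>N \<noteq> {}\<close> by (auto simp: u_def)
  have "0 = step_comb S e u" using assms by simp
  also have "\<dots> = (\<Sum>s\<in>S. if s = u then e u else 0)"
    unfolding step_comb_def
  proof (rule sum.cong, simp)
    fix s assume "s \<in> S"
    then show "e s * indicator {0<..s} u = (if s = u then e u else 0)"
      using uN le[of s] assms(2) by (auto simp: N_def indicator_def)
  qed
  also have "\<dots> = e u" using uN assms(1) by (simp add: N_def)
  finally show False using uN by (simp add: N_def)
qed

lemma step_coeff_comb:
  assumes "finite S" "S \<subseteq> {0..}"
  shows "step_coeff (step_comb S c) = (\<lambda>t. if t \<in> S \<and> 0 < t then c t else 0)"
    (is "_ = ?d")
  unfolding step_coeff_def
proof (rule the_equality)
  have fin: "finite {t. ?d t \<noteq> 0}"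
    by (rule finite_subset[OF _ assms(1)]) auto
  have "step_comb S c = step_comb {t. ?d t \<noteq> 0} ?d"
  proof
    fix x
    show "step_comb S c x = step_comb {t. ?d t \<noteq> 0} ?d x"
      unfolding step_comb_def
      by (rule sum.mono_neutral_cong_right[OF assms(1)]) (use assms(2) in \<open>auto simp: indicator_def split: if_splits\<close>)
  qed
  then show dP: "finite {t. ?d t \<noteq> 0} \<and> {t. ?d t \<noteq> 0} \<subseteq> {0<..} \<and>
             step_comb S c = step_comb {t. ?d t \<noteq> 0} ?d"
    using fin by auto
  fix b assume b: "finite {t. b t \<noteq> 0} \<and> {t. b t \<noteq> 0} \<subseteq> {0<..} \<and>
             step_comb S c = step_comb {t. b t \<noteq> 0} b"
  define A where "A = {t. b t \<noteq> 0} \<union> {t. ?d t \<noteq> 0}"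
  have A: "finite A" "A \<subseteq> {0<..}" using b dP by (auto simp: A_def)
  have ext: "step_comb {t. a t \<noteq> 0} a x = step_comb A a x" if "{t. a t \<noteq> 0} \<subseteq> A" for a x
    unfolding step_comb_def by (rule sum.mono_neutral_left) (use A that in auto)
  have "step_comb A (\<lambda>t. b t - ?d t) = (\<lambda>x. 0)"
  proof
    fix x
    have "step_comb A (\<lambda>t. b t - ?d t) x = step_comb A b x - step_comb A ?d x"
      unfolding step_comb_def by (simp only: left_diff_distrib sum_subtractf)
    also have "step_comb A b x = step_comb S c x"
      using ext[of b x] b by (auto simp: A_def)
    also have "step_comb A ?d x = step_comb S c x"
      using ext[of ?d x] dP by (metis A_def Un_upper2)
    finally show "step_comb A (\<lambda>t. b t - ?d t) x = 0" by simp
  qed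
  from step_comb_eq_zero[OF A this] have "b t = ?d t" if "t \<in> A" for t using that by simp
  moreover have "b t = ?d t" if "t \<notin> A" for t using that by (auto simp: A_def)
  ultimately show "b = ?d" by blast
qed

lemma step_inner_comb:
  assumes S: "finite S" "S \<subseteq> {0..}" and S': "finite S'" "S' \<subseteq> {0..}"
    and R0: "\<And>s. s \<in> S \<Longrightarrow> R s 0 = 0" "\<And>t. t \<in> S' \<Longrightarrow> R 0 t = 0"
  shows "step_inner R (step_comb S c) (step_comb S' d) = (\<Sum>s\<in>S. \<Sum>t\<in>S'. c s * d t * R s t)"
proof -
  let ?c = "\<lambda>t. if t \<in> S \<and> 0 < t then c t else 0"
  let ?d = "\<lambda>t. if t \<in> S' \<and> 0 < t then d t else 0"
  have "c s * d t * R s t = ?c s * ?d t * R s t" if "s \<in> S" "t \<in> S'" for s t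
  proof (cases "s = 0 \<or> t = 0")
    case True
    then have "R s t = 0" using R0(1)[OF that(1)] R0(2)[OF that(2)] by metis
    then show ?thesis by simp
  next
    case False
    then have "0 < s" "0 < t" using that S(2) S'(2) by force+
    then show ?thesis using that by simp
  qed
  then have "(\<Sum>s\<in>S. \<Sum>t\<in>S'. c s * d t * R s t) = (\<Sum>s\<in>S. \<Sum>t\<in>S'. ?c s * ?d t * R s t)"
    by (intro sum.cong refl)
  also have "\<dots> = (\<Sum>s\<in>S. \<Sum>t | ?d t \<noteq> 0. ?c s * ?d t * R s t)"
    by (rule sum.cong[OF refl], rule sum.mono_neutral_right[OF S'(1)])
       auto
  also have "\<dots> = (\<Sum>s | ?c s \<noteq> 0. \<Sum>t | ?d t \<noteq> 0. ?c s * ?d t * R s t)"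
    by (rule sum.mono_neutral_right[OF S(1)]) auto
  finally show ?thesis
    unfolding step_inner_def step_coeff_comb[OF S] step_coeff_comb[OF S'] by (rule sym)
qed

lemma indicator_eq_step_comb: "(indicator {0<..t} :: real \<Rightarrow> real) = step_comb {t} (\<lambda>_. 1)"
  by (auto simp: step_comb_def)

lemma (in centered_gaussian_process) step_inner_indicator:
  assumes "t \<in> {0..T}" "s \<in> {0..T}"
  shows "step_inner (covariance M X) (indicator {0<..t}) (indicator {0<..s}) = covariance M X t s"
proof -
  have X: "X u \<in> borel_measurable M" if "u \<in> {0..T}" for u
    using gaussian[of "{u}" "\<lambda>_. 1"] that by (simp add: gaussian_rv_def)
  have "covariance M X u 0 = 0" "covariance M X 0 u = 0" if "u \<in> {0..T}" for u
  proof -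
    have "AE \<omega> in M. X u \<omega> * X 0 \<omega> = 0" "AE \<omega> in M. X 0 \<omega> * X u \<omega> = 0"
      using start_zero by auto
    then show "covariance M X u 0 = 0" "covariance M X 0 u = 0"
      unfolding covariance_def by (auto intro: integral_eq_zero_AE)
  qed
  then show ?thesis
    using assms unfolding indicator_eq_step_comb by (subst step_inner_comb) auto
qed


section \<open>The space of deterministic integrands\<close>

text \<open>The completion, constructed as the set of Cauchy sequences of step functions modulo null
  sequences. In particular step functions at distance zero are identified.\<close>

definition step_cauchy :: "(real \<Rightarrow> real \<Rightarrow> real) \<Rightarrow> real \<Rightarrow> (nat \<Rightarrow> real \<Rightarrow> real) set" where
  "step_cauchy R T = {F. range F \<subseteq> step_space T \<and>
     (\<forall>e>0. \<exists>N. \<forall>m\<ge>N. \<forall>n\<ge>N. step_norm R (\<lambda>x. F m x - F n x) < e)}"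

definition step_rel ::
  "(real \<Rightarrow> real \<Rightarrow> real) \<Rightarrow> real \<Rightarrow> ((nat \<Rightarrow> real \<Rightarrow> real) \<times> (nat \<Rightarrow> real \<Rightarrow> real)) set" where
  "step_rel R T = {(F, G). F \<in> step_cauchy R T \<and> G \<in> step_cauchy R T \<and>
     (\<lambda>n. step_norm R (\<lambda>x. F n x - G n x)) \<longlonglongrightarrow> 0}"

type_synonym integrand = "(nat \<Rightarrow> real \<Rightarrow> real) set"

definition integrands :: "(real \<Rightarrow> real \<Rightarrow> real) \<Rightarrow> real \<Rightarrow> integrand set" where
  "integrands R T = step_cauchy R T // step_rel R T"

definition integrand_of ::
  "(real \<Rightarrow> real \<Rightarrow> real) \<Rightarrow> real \<Rightarrow> (real \<Rightarrow> real) \<Rightarrow> integrand" where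
  "integrand_of R T f = step_rel R T `` {\<lambda>n. f}"

definition integrand_rep :: "integrand \<Rightarrow> nat \<Rightarrow> real \<Rightarrow> real" where
  "integrand_rep A = (SOME F. F \<in> A)"

definition integrand_add ::
  "(real \<Rightarrow> real \<Rightarrow> real) \<Rightarrow> real \<Rightarrow> integrand \<Rightarrow> integrand \<Rightarrow> integrand" where
  "integrand_add R T A B = step_rel R T `` {\<lambda>n x. integrand_rep A n x + integrand_rep B n x}"

definition integrand_scale ::
  "(real \<Rightarrow> real \<Rightarrow> real) \<Rightarrow> real \<Rightarrow> real \<Rightarrow> integrand \<Rightarrow> integrand" where
  "integrand_scale R T c A = step_rel R T `` {\<lambda>n x. c * integrand_rep A n x}"

definition integrand_inner :: "(real \<Rightarrow> real \<Rightarrow> real) \<Rightarrow> integrand \<Rightarrow> integrand \<Rightarrow> real" where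
  "integrand_inner R A B = lim (\<lambda>n. step_inner R (integrand_rep A n) (integrand_rep B n))"

definition integrand_dist ::
  "(real \<Rightarrow> real \<Rightarrow> real) \<Rightarrow> real \<Rightarrow> integrand \<Rightarrow> integrand \<Rightarrow> real" where
  "integrand_dist R T A B =
     (let D = integrand_add R T A (integrand_scale R T (-1) B) in sqrt (integrand_inner R D D))"

definition continuous_linear_operator ::
  "(real \<Rightarrow> real \<Rightarrow> real) \<Rightarrow> real \<Rightarrow> (integrand \<Rightarrow> integrand) \<Rightarrow> bool" where
  "continuous_linear_operator R T I \<longleftrightarrow>
     I \<in> integrands R T \<rightarrow> integrands R T \<and>
     (\<forall>A\<in>integrands R T. \<forall>B\<in>integrands R T.
        I (integrand_add R T A B) = integrand_add R T (I A) (I B)) \<and>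
     (\<forall>c. \<forall>A\<in>integrands R T. I (integrand_scale R T c A) = integrand_scale R T c (I A)) \<and>
     (\<forall>A\<in>integrands R T. \<forall>e>0. \<exists>d>0. \<forall>B\<in>integrands R T.
        integrand_dist R T B A < d \<longrightarrow> integrand_dist R T (I B) (I A) < e)"

definition has_indefinite_wiener_integral ::
  "'a measure \<Rightarrow> real \<Rightarrow> (real \<Rightarrow> 'a \<Rightarrow> real) \<Rightarrow> bool" where
  "has_indefinite_wiener_integral M T X \<longleftrightarrow>
     (\<forall>r\<in>{0..T}. \<exists>I. continuous_linear_operator (covariance M X) T I \<and>
        (\<forall>t\<in>{0..T}. I (integrand_of (covariance M X) T (indicator {0<..t})) =
                    integrand_of (covariance M X) T (indicator {0<..min t r})))"


section \<open>The inner product of the completion extends the one on step functions\<close>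

lemma quadratic_nonneg_imp:
  fixes A B C :: real
  assumes nonneg: "0 \<le> B" and quad: "\<And>t. 0 \<le> A + 2 * t * C + t\<^sup>2 * B"
  shows "\<bar>C\<bar> \<le> sqrt A * sqrt B"
proof -
  have "C\<^sup>2 \<le> A * B"
  proof (cases "B = 0")
    case True
    have "C = 0"
    proof (rule ccontr)
      assume "C \<noteq> 0"
      then show False using quad[of "- (A + 1) / (2 * C)"] True by (simp add: field_simps)
    qed
    with True show ?thesis by simp
  next
    case False
    with nonneg have "0 < B" by simp
    then show ?thesis
      using quad[of "- C / B"] by (simp add: field_simps power2_eq_square)
  qed
  then have "sqrt (C\<^sup>2) \<le> sqrt (A * B)" by (rule real_sqrt_le_mono)
  then show ?thesis by (simp add: real_sqrt_mult)
qed

lemma step_comb_extend: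
  assumes "finite U" "S \<subseteq> U"
  shows "step_comb S c = step_comb U (\<lambda>t. if t \<in> S then c t else 0)"
proof
  fix x
  show "step_comb S c x = step_comb U (\<lambda>t. if t \<in> S then c t else 0) x"
    unfolding step_comb_def by (rule sum.mono_neutral_cong_left) (use assms in auto)
qed

lemma step_space_common:
  assumes "f \<in> step_space T" "g \<in> step_space T"
  obtains S a b where "finite S" "S \<subseteq> {0..T}" "f = step_comb S a" "g = step_comb S b"
proof -
  from assms obtain S a S' b where
    1: "finite S" "S \<subseteq> {0..T}" "f = step_comb S a" and
    2: "finite S'" "S' \<subseteq> {0..T}" "g = step_comb S' b"
    by (auto simp: step_space_def)
  have "f = step_comb (S \<union> S') (\<lambda>t. if t \<in> S then a t else 0)"
    unfolding 1(3) by (rule step_comb_extend) (use 1 2 in auto)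
  moreover have "g = step_comb (S \<union> S') (\<lambda>t. if t \<in> S' then b t else 0)"
    unfolding 2(3) by (rule step_comb_extend) (use 1 2 in auto)
  ultimately show ?thesis using that[of "S \<union> S'"] 1 2 by blast
qed

lemma step_space_lincomb:
  assumes "f \<in> step_space T" "g \<in> step_space T"
  shows "(\<lambda>x. f x + c * g x) \<in> step_space T"
    and "step_coeff (\<lambda>x. f x + c * g x) = (\<lambda>t. step_coeff f t + c * step_coeff g t)"
proof -
  obtain S a b where S: "finite S" "S \<subseteq> {0..T}" "f = step_comb S a" "g = step_comb S b"
    using step_space_common[OF assms] by blast
  have S0: "S \<subseteq> {0..}" using S(2) by auto
  have eq: "(\<lambda>x. f x + c * g x) = step_comb S (\<lambda>t. a t + c * b t)"
    unfolding S step_comb_def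
    by (simp only: distrib_right sum.distrib sum_distrib_left mult.assoc)
  then show "(\<lambda>x. f x + c * g x) \<in> step_space T"
    using S unfolding step_space_def by blast
  show "step_coeff (\<lambda>x. f x + c * g x) = (\<lambda>t. step_coeff f t + c * step_coeff g t)"
    unfolding eq unfolding S(3,4) step_coeff_comb[OF S(1) S0] by auto
qed

lemma step_coeff_support:
  assumes "f \<in> step_space T"
  shows "finite {t. step_coeff f t \<noteq> 0}" "{t. step_coeff f t \<noteq> 0} \<subseteq> {0..T}"
proof -
  obtain S a where S: "finite S" "S \<subseteq> {0..T}" "f = step_comb S a"
    using assms by (auto simp: step_space_def)
  then have S0: "S \<subseteq> {0..}" by auto
  have "{t. step_coeff f t \<noteq> 0} \<subseteq> S"
    unfolding S(3) step_coeff_comb[OF S(1) S0] by (auto split: if_splits)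
  then show "finite {t. step_coeff f t \<noteq> 0}" "{t. step_coeff f t \<noteq> 0} \<subseteq> {0..T}"
    using S finite_subset by auto
qed

context centered_gaussian_process
begin

abbreviation "R \<equiv> covariance M X"

lemma gaussian_rv_square_integrable:
  assumes "gaussian_rv M Y"
  shows "integrable M (\<lambda>\<omega>. (Y \<omega>)\<^sup>2)"
proof -
  have Y[measurable]: "Y \<in> borel_measurable M" using assms by (simp add: gaussian_rv_def)
  from assms consider
    (const) \<mu> where "AE \<omega> in M. Y \<omega> = \<mu>"
  | (normal) \<mu> \<sigma> where "\<sigma> > 0" "distributed M lborel Y (normal_density \<mu> \<sigma>)"
    by (auto simp: gaussian_rv_def)
  then show ?thesis
  proof cases
    case const
    then have ae: "AE \<omega> in M. (Y \<omega>)\<^sup>2 = \<mu>\<^sup>2" by eventually_elim simp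
    show ?thesis by (rule integrable_cong_AE_imp[of M "\<lambda>_. \<mu>\<^sup>2"]) (use ae in auto)
  next
    case normal
    have i: "integrable lborel (\<lambda>x. normal_density \<mu> \<sigma> x * (x - \<mu>) ^ k)" for k
      by (rule integrable_normal_moment[OF normal(1)])
    have "integrable lborel (\<lambda>x. normal_density \<mu> \<sigma> x * (x - \<mu>) ^ 2
       + 2 * \<mu> * (normal_density \<mu> \<sigma> x * (x - \<mu>) ^ 1) + \<mu>\<^sup>2 * (normal_density \<mu> \<sigma> x * (x - \<mu>) ^ 0))"
      by (intro Bochner_Integration.integrable_add integrable_mult_right i)
    also have "(\<lambda>x. normal_density \<mu> \<sigma> x * (x - \<mu>) ^ 2
       + 2 * \<mu> * (normal_density \<mu> \<sigma> x * (x - \<mu>) ^ 1) + \<mu>\<^sup>2 * (normal_density \<mu> \<sigma> x * (x - \<mu>) ^ 0))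
      = (\<lambda>x. normal_density \<mu> \<sigma> x * x\<^sup>2)"
      by (auto simp: power2_eq_square algebra_simps)
    finally show ?thesis
      using distributed_integrable[OF normal(2), of "\<lambda>x. x\<^sup>2"] by simp
  qed
qed

definition step_rv :: "(real \<Rightarrow> real) \<Rightarrow> 'a \<Rightarrow> real" where
  "step_rv f \<omega> = (\<Sum>t | step_coeff f t \<noteq> 0. step_coeff f t * X t \<omega>)"

lemma process_rv:
  assumes "t \<in> {0..T}"
  shows "X t \<in> borel_measurable M" "integrable M (\<lambda>\<omega>. (X t \<omega>)\<^sup>2)"
proof -
  have g: "gaussian_rv M (X t)"
    using gaussian[of "{t}" "\<lambda>_. 1"] assms by simp
  then show "X t \<in> borel_measurable M" by (simp add: gaussian_rv_def)
  show "integrable M (\<lambda>\<omega>. (X t \<omega>)\<^sup>2)" by (rule gaussian_rv_square_integrable[OF g])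
qed

lemma integrable_prod:
  fixes Y Z :: "'a \<Rightarrow> real"
  assumes [measurable]: "Y \<in> borel_measurable M" "Z \<in> borel_measurable M"
    and "integrable M (\<lambda>\<omega>. (Y \<omega>)\<^sup>2)" "integrable M (\<lambda>\<omega>. (Z \<omega>)\<^sup>2)"
  shows "integrable M (\<lambda>\<omega>. Y \<omega> * Z \<omega>)"
proof (rule Bochner_Integration.integrable_bound)
  show "integrable M (\<lambda>\<omega>. (Y \<omega>)\<^sup>2 + (Z \<omega>)\<^sup>2)" using assms by simp
  have "\<bar>y * z\<bar> \<le> y\<^sup>2 + z\<^sup>2" for y z :: real
  proof -
    have "2 * (\<bar>y\<bar> * \<bar>z\<bar>) \<le> \<bar>y\<bar>\<^sup>2 + \<bar>z\<bar>\<^sup>2"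
      using sum_squares_bound[of "\<bar>y\<bar>" "\<bar>z\<bar>"] by simp
    moreover have "0 \<le> \<bar>y\<bar> * \<bar>z\<bar>" by simp
    ultimately show ?thesis unfolding abs_mult power2_abs by linarith
  qed
  then show "AE \<omega> in M. norm (Y \<omega> * Z \<omega>) \<le> norm ((Y \<omega>)\<^sup>2 + (Z \<omega>)\<^sup>2)"
    by simp
qed measurable

lemma step_rv:
  assumes "f \<in> step_space T"
  shows "step_rv f \<in> borel_measurable M" "integrable M (\<lambda>\<omega>. (step_rv f \<omega>)\<^sup>2)"
proof -
  have g: "gaussian_rv M (step_rv f)"
    unfolding step_rv_def[abs_def] by (rule gaussian) (rule step_coeff_support[OF assms])+
  then show "step_rv f \<in> borel_measurable M" by (simp add: gaussian_rv_def)
  show "integrable M (\<lambda>\<omega>. (step_rv f \<omega>)\<^sup>2)" by (rule gaussian_rv_square_integrable[OF g])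
qed

lemma step_rv_lincomb:
  assumes "f \<in> step_space T" "g \<in> step_space T"
  shows "step_rv (\<lambda>x. f x + c * g x) \<omega> = step_rv f \<omega> + c * step_rv g \<omega>"
proof -
  let ?U = "{t. step_coeff f t \<noteq> 0} \<union> {t. step_coeff g t \<noteq> 0}"
  have fin: "finite ?U" using assms step_coeff_support(1) by blast
  have ext: "step_rv h \<omega> = (\<Sum>t\<in>?U. step_coeff h t * X t \<omega>)"
    if "{t. step_coeff h t \<noteq> 0} \<subseteq> ?U" for h
    unfolding step_rv_def by (rule sum.mono_neutral_left) (use fin that in auto)
  have "{t. step_coeff (\<lambda>x. f x + c * g x) t \<noteq> 0} \<subseteq> ?U"
    unfolding step_space_lincomb(2)[OF assms] by auto
  then have "step_rv (\<lambda>x. f x + c * g x) \<omega> =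
      (\<Sum>t\<in>?U. (step_coeff f t + c * step_coeff g t) * X t \<omega>)"
    using ext step_space_lincomb(2)[OF assms] by simp
  also have "\<dots> = step_rv f \<omega> + c * step_rv g \<omega>"
    using ext[of f] ext[of g] by (simp add: distrib_right sum.distrib sum_distrib_left mult.assoc)
  finally show ?thesis .
qed

lemma step_inner_eq:
  assumes "f \<in> step_space T" "g \<in> step_space T"
  shows "step_inner R f g = (\<integral>\<omega>. step_rv f \<omega> * step_rv g \<omega> \<partial>M)"
proof -
  note f = step_coeff_support[OF assms(1)] and g = step_coeff_support[OF assms(2)]
  have i: "integrable M (\<lambda>\<omega>. X s \<omega> * X t \<omega>)" if "s \<in> {0..T}" "t \<in> {0..T}" for s t
    using that process_rv by (intro integrable_prod) auto
  have i': "integrable M (\<lambda>\<omega>. (step_coeff f s * step_coeff g t) * (X s \<omega> * X t \<omega>))"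
    if "s \<in> {t. step_coeff f t \<noteq> 0}" "t \<in> {t. step_coeff g t \<noteq> 0}" for s t
    using that f(2) g(2) by (intro integrable_mult_right i) auto
  have "(\<integral>\<omega>. step_rv f \<omega> * step_rv g \<omega> \<partial>M) =
    (\<integral>\<omega>. (\<Sum>s | step_coeff f s \<noteq> 0. \<Sum>t | step_coeff g t \<noteq> 0.
        (step_coeff f s * step_coeff g t) * (X s \<omega> * X t \<omega>)) \<partial>M)"
    unfolding step_rv_def sum_product by (simp add: ac_simps)
  also have "\<dots> = (\<Sum>s | step_coeff f s \<noteq> 0. \<integral>\<omega>. (\<Sum>t | step_coeff g t \<noteq> 0.
        (step_coeff f s * step_coeff g t) * (X s \<omega> * X t \<omega>)) \<partial>M)"
    by (rule Bochner_Integration.integral_sum, rule Bochner_Integration.integrable_sum, rule i')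
  also have "\<dots> = (\<Sum>s | step_coeff f s \<noteq> 0. \<Sum>t | step_coeff g t \<noteq> 0.
        \<integral>\<omega>. (step_coeff f s * step_coeff g t) * (X s \<omega> * X t \<omega>) \<partial>M)"
    by (rule sum.cong[OF refl], rule Bochner_Integration.integral_sum, rule i')
  also have "\<dots> = step_inner R f g"
    unfolding step_inner_def covariance_def by simp
  finally show ?thesis by simp
qed

lemma step_norm_eq:
  assumes "f \<in> step_space T"
  shows "step_norm R f = sqrt (\<integral>\<omega>. (step_rv f \<omega>)\<^sup>2 \<partial>M)"
  using step_inner_eq[OF assms assms] by (simp add: step_norm_def power2_eq_square)

lemma step_inner_lincomb:
  assumes "f \<in> step_space T" "g \<in> step_space T" "h \<in> step_space T"
  shows "step_inner R h (\<lambda>x. f x + c * g x) = step_inner R h f + c * step_inner R h g"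
proof -
  have i: "integrable M (\<lambda>\<omega>. step_rv h \<omega> * step_rv k \<omega>)" if "k \<in> step_space T" for k
    using that assms step_rv by (intro integrable_prod) auto
  have "step_inner R h (\<lambda>x. f x + c * g x) =
     (\<integral>\<omega>. step_rv h \<omega> * step_rv f \<omega> + c * (step_rv h \<omega> * step_rv g \<omega>) \<partial>M)"
    using assms step_space_lincomb(1)[OF assms(1,2), of c]
    by (simp add: step_inner_eq step_rv_lincomb algebra_simps)
  also have "\<dots> = step_inner R h f + c * step_inner R h g"
    using i assms by (simp add: step_inner_eq)
  finally show ?thesis .
qed

lemma step_inner_commute:
  "f \<in> step_space T \<Longrightarrow> g \<in> step_space T \<Longrightarrow> step_inner R f g = step_inner R g f"
  by (simp add: step_inner_eq mult.commute)

lemma step_inner_nonneg: "f \<in> step_space T \<Longrightarrow> 0 \<le> step_inner R f f"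
  by (simp add: step_inner_eq)

lemma step_Cauchy_Schwarz:
  assumes f: "f \<in> step_space T" and g: "g \<in> step_space T"
  shows "\<bar>step_inner R f g\<bar> \<le> step_norm R f * step_norm R g"
  unfolding step_norm_def
proof (rule quadratic_nonneg_imp[OF step_inner_nonneg[OF g]])
  fix t
  let ?h = "\<lambda>x. f x + t * g x"
  have h: "?h \<in> step_space T" by (rule step_space_lincomb(1)[OF f g])
  have "step_inner R ?h ?h = step_inner R f ?h + t * step_inner R g ?h"
    using step_inner_lincomb[OF f g h, of t]
      step_inner_commute[OF h f] step_inner_commute[OF h g] by simp
  also have "\<dots> = step_inner R f f + 2 * t * step_inner R f g + t\<^sup>2 * step_inner R g g"
    using step_inner_lincomb[OF f g f, of t] step_inner_lincomb[OF f g g, of t]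
      step_inner_commute[OF f g] by (simp add: algebra_simps power2_eq_square)
  finally show "0 \<le> step_inner R f f + 2 * t * step_inner R f g + t\<^sup>2 * step_inner R g g"
    using step_inner_nonneg[OF h] by simp
qed

lemma rep_integrand_of:
  assumes f: "f \<in> step_space T"
  shows "integrand_rep (integrand_of R T f) n \<in> step_space T"
    and "(\<lambda>n. step_norm R (\<lambda>x. f x - integrand_rep (integrand_of R T f) n x)) \<longlonglongrightarrow> 0"
proof -
  have z: "step_norm R (\<lambda>x. f x - f x) = 0"
    using step_space_lincomb(2)[OF f f, of "-1"] by (simp add: step_norm_def step_inner_def)
  have "(\<lambda>n. f) \<in> integrand_of R T f"
    using f z by (auto simp: integrand_of_def step_rel_def step_cauchy_def)
  then have "integrand_rep (integrand_of R T f) \<in> integrand_of R T f"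
    unfolding integrand_rep_def by (rule someI[where P = "\<lambda>F. F \<in> _"])
  then show "integrand_rep (integrand_of R T f) n \<in> step_space T"
    "(\<lambda>n. step_norm R (\<lambda>x. f x - integrand_rep (integrand_of R T f) n x)) \<longlonglongrightarrow> 0"
    by (auto simp: integrand_of_def step_rel_def step_cauchy_def)
qed

lemma integrand_inner_of:
  assumes f: "f \<in> step_space T" and g: "g \<in> step_space T"
  shows "integrand_inner R (integrand_of R T f) (integrand_of R T g) = step_inner R f g"
proof -
  define F where "F = integrand_rep (integrand_of R T f)"
  define G where "G = integrand_rep (integrand_of R T g)"
  note F = rep_integrand_of[OF f, folded F_def] and G = rep_integrand_of[OF g, folded G_def]
  define a where "a n = step_norm R (\<lambda>x. f x - F n x)" for n
  define b where "b n = step_norm R (\<lambda>x. g x - G n x)" for n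
  have bound: "\<bar>step_inner R (F n) (G n) - step_inner R f g\<bar>
      \<le> step_norm R f * b n + a n * step_norm R g + a n * b n" for n
  proof -
    let ?u = "\<lambda>x. f x - F n x" and ?v = "\<lambda>x. g x - G n x"
    have u: "?u \<in> step_space T" and v: "?v \<in> step_space T"
      using step_space_lincomb(1)[OF f F(1), of "-1"] step_space_lincomb(1)[OF g G(1), of "-1"]
      by simp_all
    have "step_inner R h (G n) = step_inner R h g - step_inner R h ?v" if "h \<in> step_space T" for h
      using step_inner_lincomb[OF g v that, of "-1"] by simp
    moreover have "step_inner R (F n) h = step_inner R f h - step_inner R ?u h"
      if h: "h \<in> step_space T" for h
      using step_inner_lincomb[OF f u h, of "-1"] step_inner_commute[OF F(1) h]
        step_inner_commute[OF f h] step_inner_commute[OF u h] by simp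
    ultimately have "step_inner R (F n) (G n) - step_inner R f g =
        - step_inner R f ?v - step_inner R ?u g + step_inner R ?u ?v"
      using f u g v F(1) G(1) by simp
    moreover note step_Cauchy_Schwarz[OF f v] step_Cauchy_Schwarz[OF u g] step_Cauchy_Schwarz[OF u v]
    ultimately show ?thesis unfolding a_def b_def by linarith
  qed
  have "(\<lambda>n. step_norm R f * b n + a n * step_norm R g + a n * b n) \<longlonglongrightarrow>
      step_norm R f * 0 + 0 * step_norm R g + 0 * 0"
    by (intro tendsto_intros) (use F(2) G(2) in \<open>simp_all add: a_def b_def\<close>)
  then have lim0: "(\<lambda>n. step_norm R f * b n + a n * step_norm R g + a n * b n) \<longlonglongrightarrow> 0"
    by simp
  have "(\<lambda>n. step_inner R (F n) (G n) - step_inner R f g) \<longlonglongrightarrow> 0"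
    by (rule Lim_null_comparison[OF always_eventually lim0]) (simp only: real_norm_def bound simp_thms)
  then have "(\<lambda>n. step_inner R (F n) (G n)) \<longlonglongrightarrow> step_inner R f g"
    by (simp add: LIM_zero_iff)
  then show ?thesis unfolding integrand_inner_def F_def G_def by (rule limI)
qed

lemma integrand_inner_indicator:
  assumes "t \<in> {0..T}" "s \<in> {0..T}"
  shows "integrand_inner R (integrand_of R T (indicator {0<..t})) (integrand_of R T (indicator {0<..s}))
           = R t s"
proof -
  have "(indicator {0<..u} :: real \<Rightarrow> real) \<in> step_space T" if "u \<in> {0..T}" for u
    unfolding indicator_eq_step_comb step_space_def using that by blast
  then show ?thesis
    using assms by (simp add: integrand_inner_of step_inner_indicator)
qed

end

end

theory Submission
  imports Defs
begin

text \<open>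
  Cutting a step function off at time \<open>r\<close> maps \<open>1\<^bsub>(0,t]\<^esub>\<close> to
  \<open>1\<^bsub>(0,min t r]\<^esub>\<close>. Both statements say that this linear map is bounded for the seminorm
  which the covariance defines on the step functions, for every \<open>r\<close> (\<open>step_cut_bounded\<close>).

  For the Wiener integral this is the extension principle: a continuous linear operator on the
  completion restricts to a bounded map on the dense image of the step functions, and a bounded
  map extends to the completion (\<open>wiener_integral_iff\<close>).

  For the Cameron-Martin space, the first chaos is the isometric image of the completion, so a
  Cameron-Martin function is \<open>t \<mapsto> lim \<langle>1\<^bsub>(0,t]\<^esub>, F\<^sub>n\<rangle>\<close> for a Cauchy sequence
  \<open>F\<close> of step functions, and conversely (\<open>cameron_martin_iff\<close>). Its truncation at \<open>r\<close>
  is the functional \<open>f \<mapsto> lim \<langle>step_cut r f, F\<^sub>n\<rangle>\<close> evaluated at indicators. If cutting is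
  bounded, this functional is bounded, and the Riesz theorem (\<open>riesz_representation\<close>) puts the
  truncation in the Cameron-Martin space. If the space is closed under truncation, then every such
  functional is represented by an element of the completion and hence bounded; that is, the
  set of all \<open>step_cut r f\<close> with \<open>\<parallel>f\<parallel> \<le> 1\<close> is weakly bounded, and the uniform boundedness principle
  (\<open>uniform_boundedness\<close>) makes it bounded in seminorm.

  All Hilbert space arguments are carried out with Cauchy sequences of step functions. Only the
  description of the first chaos uses the completeness of \<open>L\<^sup>2\<close>, in the form that the limit can
  be chosen measurable for the \<open>\<sigma>\<close>-algebra of the process (\<open>L2_complete\<close>).\<close>

section \<open>Step functions and their truncation in time\<close>

lemma zero_step: "(\<lambda>x. 0) \<in> step_space T"
proof -
  have "step_comb {} (\<lambda>_. 0) \<in> step_space T"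
    unfolding step_space_def by blast
  then show ?thesis by (simp add: step_comb_def)
qed

lemma indicator_step: "t \<in> {0..T} \<Longrightarrow> indicator {0<..t} \<in> step_space T"
  unfolding indicator_eq_step_comb step_space_def by blast

lemma step_space_scale: "f \<in> step_space T \<Longrightarrow> (\<lambda>x. c * f x) \<in> step_space T"
  using step_space_lincomb(1)[OF zero_step] by simp

lemma step_space_diff: "f \<in> step_space T \<Longrightarrow> g \<in> step_space T \<Longrightarrow> (\<lambda>x. f x - g x) \<in> step_space T"
  using step_space_lincomb(1)[of f T g "-1"] by simp

lemma step_space_induct [consumes 1, case_names zero lincomb]:
  assumes "f \<in> step_space T"
    and "P (\<lambda>x. 0)"
    and "\<And>g c t. g \<in> step_space T \<Longrightarrow> t \<in> {0..T} \<Longrightarrow> P g \<Longrightarrow> P (\<lambda>x. g x + c * indicator {0<..t} x)"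
  shows "P f"
proof -
  obtain S c where S: "finite S" "S \<subseteq> {0..T}" and f: "f = step_comb S c"
    using assms(1) by (auto simp: step_space_def)
  from S have "step_comb S c \<in> step_space T \<and> P (step_comb S c)"
  proof (induction S)
    case empty
    then show ?case using assms(2) zero_step by (simp add: step_comb_def)
  next
    case (insert t S)
    then have eq: "step_comb (insert t S) c = (\<lambda>x. step_comb S c x + c t * indicator {0<..t} x)"
      unfolding step_comb_def by (simp only: sum.insert add.commute not_False_eq_True)
    show ?case unfolding eq
      using insert assms(3) step_space_lincomb(1) indicator_step by simp
  qed
  then show ?thesis using f by simp
qed

definition step_cut :: "real \<Rightarrow> (real \<Rightarrow> real) \<Rightarrow> real \<Rightarrow> real" where
  "step_cut r f = (\<lambda>x. if x \<le> r then f x else 0)"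

lemma step_cut_lincomb: "step_cut r (\<lambda>x. f x + c * g x) = (\<lambda>x. step_cut r f x + c * step_cut r g x)"
  by (auto simp: step_cut_def)

lemma step_cut_diff: "step_cut r (\<lambda>x. f x - g x) = (\<lambda>x. step_cut r f x - step_cut r g x)"
  by (auto simp: step_cut_def)

lemma step_cut_indicator: "step_cut r (indicator {0<..t}) = indicator {0<..min t r}"
  by (auto simp: step_cut_def indicator_def)

lemma step_cut_in_step_space:
  assumes "f \<in> step_space T" "r \<in> {0..T}"
  shows "step_cut r f \<in> step_space T"
  using assms(1)
proof (induction rule: step_space_induct)
  case zero
  then show ?case using zero_step by (simp add: step_cut_def)
next
  case (lincomb g c t)
  have "(\<lambda>x. step_cut r g x + c * indicator {0<..min t r} x) \<in> step_space T"
    by (rule step_space_lincomb(1)[OF lincomb(3) indicator_step]) (use lincomb assms(2) in auto)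
  then show ?case by (simp only: step_cut_lincomb step_cut_indicator)
qed

section \<open>The covariance seminorm\<close>

context centered_gaussian_process
begin

abbreviation "V \<equiv> step_space T"
abbreviation "ip \<equiv> step_inner R"
abbreviation "nm \<equiv> step_norm R"

lemma nm_nonneg: "f \<in> V \<Longrightarrow> 0 \<le> nm f"
  by (simp add: step_norm_def step_inner_nonneg)

lemma nm_sq: "f \<in> V \<Longrightarrow> (nm f)\<^sup>2 = ip f f"
  by (simp add: step_norm_def step_inner_nonneg)

lemma ip_diff: "f \<in> V \<Longrightarrow> g \<in> V \<Longrightarrow> h \<in> V \<Longrightarrow> ip h (\<lambda>x. f x - g x) = ip h f - ip h g"
  using step_inner_lincomb[of f g h "-1"] by simp

lemma ip_lincomb_left:
  "f \<in> V \<Longrightarrow> g \<in> V \<Longrightarrow> h \<in> V \<Longrightarrow> ip (\<lambda>x. f x + c * g x) h = ip f h + c * ip g h"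
  using step_inner_lincomb[of f g h c] by (simp add: step_inner_commute step_space_lincomb(1))

lemma nm_lincomb_sq:
  assumes "f \<in> V" "g \<in> V"
  shows "(nm (\<lambda>x. f x + c * g x))\<^sup>2 = (nm f)\<^sup>2 + 2 * c * ip f g + c\<^sup>2 * (nm g)\<^sup>2"
proof -
  have "(nm (\<lambda>x. f x + c * g x))\<^sup>2 = ip f f + 2 * c * ip f g + c\<^sup>2 * ip g g"
    unfolding nm_sq[OF step_space_lincomb(1)[OF assms]]
    using assms step_inner_commute[of f g]
    by (simp add: step_space_lincomb(1) step_inner_lincomb ip_lincomb_left
        algebra_simps power2_eq_square)
  then show ?thesis by (simp only: nm_sq assms)
qed

lemma nm_lincomb_le:
  assumes "f \<in> V" "g \<in> V"
  shows "nm (\<lambda>x. f x + c * g x) \<le> nm f + \<bar>c\<bar> * nm g"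
proof (rule power2_le_imp_le)
  have "c * ip f g \<le> \<bar>c\<bar> * \<bar>ip f g\<bar>" by (metis abs_ge_self abs_mult)
  also have "\<dots> \<le> \<bar>c\<bar> * (nm f * nm g)"
    using assms by (intro mult_left_mono step_Cauchy_Schwarz) auto
  finally show "(nm (\<lambda>x. f x + c * g x))\<^sup>2 \<le> (nm f + \<bar>c\<bar> * nm g)\<^sup>2"
    unfolding nm_lincomb_sq[OF assms] by (simp add: power2_sum power_mult_distrib algebra_simps)
  show "0 \<le> nm f + \<bar>c\<bar> * nm g" using assms nm_nonneg by simp
qed

lemma nm_triangle:
  assumes "f \<in> V" "g \<in> V" "h \<in> V"
  shows "nm (\<lambda>x. f x - h x) \<le> nm (\<lambda>x. f x - g x) + nm (\<lambda>x. g x - h x)"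
  using nm_lincomb_le[of "\<lambda>x. f x - g x" "\<lambda>x. g x - h x" 1] assms
  by (simp add: step_space_diff)

lemma ip_zero: "h \<in> V \<Longrightarrow> ip h (\<lambda>x. 0) = 0"
  using ip_diff[of h h h] by simp

lemma ip_scale: "f \<in> V \<Longrightarrow> h \<in> V \<Longrightarrow> ip h (\<lambda>x. c * f x) = c * ip h f"
  using step_inner_lincomb[of "\<lambda>x. 0" f h c] by (simp add: zero_step ip_zero)

lemma nm_scale:
  assumes "f \<in> V" shows "nm (\<lambda>x. c * f x) = \<bar>c\<bar> * nm f"
proof -
  have "ip (\<lambda>x. c * f x) (\<lambda>x. c * f x) = c\<^sup>2 * ip f f"
    using assms step_inner_commute[of "\<lambda>x. c * f x" f]
    by (simp add: ip_scale step_space_scale power2_eq_square)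
  then show ?thesis by (simp add: step_norm_def real_sqrt_mult)
qed

lemma nm_zero: "nm (\<lambda>x. 0) = 0"
  using nm_scale[OF zero_step, of 0] by simp

lemma nm_commute: "f \<in> V \<Longrightarrow> g \<in> V \<Longrightarrow> nm (\<lambda>x. f x - g x) = nm (\<lambda>x. g x - f x)"
  using nm_scale[of "\<lambda>x. f x - g x" "-1"] by (simp add: step_space_diff)

lemma nm_diff_abs: "f \<in> V \<Longrightarrow> g \<in> V \<Longrightarrow> \<bar>nm f - nm g\<bar> \<le> nm (\<lambda>x. f x - g x)"
  using nm_triangle[of f g "\<lambda>x. 0"] nm_triangle[of g f "\<lambda>x. 0"] nm_commute[of f g] zero_step
  by simp

lemma step_cauchyD:
  assumes "F \<in> step_cauchy R T"
  shows "F n \<in> V" "e > 0 \<Longrightarrow> \<exists>N. \<forall>m\<ge>N. \<forall>n\<ge>N. nm (\<lambda>x. F m x - F n x) < e"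
  using assms by (auto simp: step_cauchy_def)

lemma step_cauchyI:
  assumes "\<And>n. F n \<in> V" "\<And>e. e > 0 \<Longrightarrow> \<exists>N. \<forall>m\<ge>N. \<forall>n\<ge>N. nm (\<lambda>x. F m x - F n x) < e"
  shows "F \<in> step_cauchy R T"
  using assms by (auto simp: step_cauchy_def)

lemma cauchy_nm_convergent:
  assumes F: "F \<in> step_cauchy R T"
  shows "convergent (\<lambda>n. nm (F n))"
proof -
  have "Cauchy (\<lambda>n. nm (F n))"
  proof (rule metric_CauchyI)
    fix e :: real assume "e > 0"
    then obtain N where "\<forall>m\<ge>N. \<forall>n\<ge>N. nm (\<lambda>x. F m x - F n x) < e"
      using step_cauchyD(2)[OF F] by blast
    then show "\<exists>N. \<forall>m\<ge>N. \<forall>n\<ge>N. dist (nm (F m)) (nm (F n)) < e"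
      unfolding dist_real_def using nm_diff_abs[OF step_cauchyD(1)[OF F] step_cauchyD(1)[OF F]]
      by (meson order_le_less_trans)
  qed
  then show ?thesis by (simp add: Cauchy_convergent_iff)
qed

lemma cauchy_bounded:
  assumes F: "F \<in> step_cauchy R T"
  obtains K where "\<And>n. nm (F n) \<le> K"
  using convergent_imp_Bseq[OF cauchy_nm_convergent[OF F]]
  by (auto simp: Bseq_def abs_le_iff)

lemma cauchy_ip_convergent:
  assumes F: "F \<in> step_cauchy R T" and f: "f \<in> V"
  shows "convergent (\<lambda>n. ip f (F n))"
proof -
  have "Cauchy (\<lambda>n. ip f (F n))"
  proof (rule metric_CauchyI)
    fix e :: real assume "e > 0"
    then obtain N where N: "\<forall>m\<ge>N. \<forall>n\<ge>N. nm (\<lambda>x. F m x - F n x) < e / (nm f + 1)"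
      using step_cauchyD(2)[OF F, of "e / (nm f + 1)"] nm_nonneg[OF f] by auto
    show "\<exists>N. \<forall>m\<ge>N. \<forall>n\<ge>N. dist (ip f (F m)) (ip f (F n)) < e"
    proof (intro exI allI impI)
      fix m n assume mn: "m \<ge> N" "n \<ge> N"
      let ?d = "nm (\<lambda>x. F m x - F n x)"
      have "dist (ip f (F m)) (ip f (F n)) = \<bar>ip f (\<lambda>x. F m x - F n x)\<bar>"
        using ip_diff[OF step_cauchyD(1)[OF F] step_cauchyD(1)[OF F] f] by (simp add: dist_real_def)
      also have "\<dots> \<le> nm f * ?d"
        by (rule step_Cauchy_Schwarz[OF f step_space_diff[OF step_cauchyD(1)[OF F] step_cauchyD(1)[OF F]]])
      also have "\<dots> \<le> (nm f + 1) * ?d"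
        by (intro mult_right_mono nm_nonneg step_space_diff step_cauchyD(1)[OF F]) simp
      also have "\<dots> < (nm f + 1) * (e / (nm f + 1))"
        using N mn nm_nonneg[OF f] by (intro mult_strict_left_mono) auto
      also have "\<dots> = e" using nm_nonneg[OF f] by simp
      finally show "dist (ip f (F m)) (ip f (F n)) < e" .
    qed
  qed
  then show ?thesis by (simp add: Cauchy_convergent_iff)
qed

section \<open>Uniform boundedness and Riesz representation for step functions\<close>

text \<open>This is the uniform boundedness principle for the functionals \<open>\<langle>P f, \<cdot>\<rangle>\<close>, \<open>\<parallel>f\<parallel> \<le> 1\<close>,
  on the completion. The argument is a gliding hump: if \<open>P\<close> is unbounded, choose \<open>f\<^sub>n\<close> with
  \<open>g\<^sub>n = P f\<^sub>n\<close> satisfying \<open>\<parallel>g\<^sub>n\<parallel> > 4\<^sup>n \<parallel>f\<^sub>n\<parallel>\<close>, and let \<open>u\<close> perform steps of length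
  \<open>3\<^sup>-\<^sup>n\<close> in the directions \<open>\<plusminus>g\<^sub>n\<close>. The sign makes step \<open>n\<close> contribute at least
  \<open>3\<^sup>-\<^sup>n \<parallel>g\<^sub>n\<parallel>\<close> to \<open>\<bar>\<langle>g\<^sub>n, u\<rangle>\<bar>\<close>, and all later steps together can remove only half of that.
  So \<open>\<bar>lim \<langle>g\<^sub>n, u\<rangle>\<bar> \<ge> 3\<^sup>-\<^sup>n \<parallel>g\<^sub>n\<parallel> / 2 > (4/3)\<^sup>n \<parallel>f\<^sub>n\<parallel> / 2\<close>, against weak boundedness at \<open>u\<close>.\<close>

lemma uniform_boundedness:
  assumes P: "\<And>f. f \<in> V \<Longrightarrow> P f \<in> V"
    and weak: "\<And>F. F \<in> step_cauchy R T \<Longrightarrow>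
      \<exists>K. \<forall>f\<in>V. \<forall>l. (\<lambda>n. ip (P f) (F n)) \<longlonglongrightarrow> l \<longrightarrow> \<bar>l\<bar> \<le> K * nm f"
  shows "\<exists>C. \<forall>f\<in>V. nm (P f) \<le> C * nm f"
proof (rule ccontr)
  assume "\<not> ?thesis"
  then have "\<forall>n::nat. \<exists>f\<in>V. nm (P f) > 4 ^ n * nm f" by (auto simp: not_le)
  then obtain f where f: "\<And>n. f n \<in> V" and big: "\<And>n::nat. nm (P (f n)) > 4 ^ n * nm (f n)"
    by metis
  define g where "g n = P (f n)" for n
  have g: "g n \<in> V" for n by (simp add: g_def P f)
  have gpos: "nm (g n) > 0" for n
  proof -
    have "0 \<le> 4 ^ n * nm (f n)" using f nm_nonneg by simp
    then show ?thesis using big[of n] by (simp add: g_def)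
  qed
  define s :: "nat \<Rightarrow> (real \<Rightarrow> real) \<Rightarrow> real"
    where "s n u = (if 0 \<le> ip (g n) u then 1 else -1)" for n u
  define u where "u = rec_nat (\<lambda>x. 0) (\<lambda>n v x. v x + s n v / (3 ^ n * nm (g n)) * g n x)"
  have u_Suc: "u (Suc n) = (\<lambda>x. u n x + s n (u n) / (3 ^ n * nm (g n)) * g n x)" for n
    by (simp add: u_def)
  have u: "u n \<in> V" for n
    by (induction n) (simp_all only: u_Suc step_space_lincomb(1) g, simp add: u_def zero_step)
  have s_abs: "\<bar>s n v\<bar> = 1" for n v by (simp add: s_def)
  have inc: "nm (\<lambda>x. u (Suc n) x - u n x) = (1/3) ^ n" for n
    using nm_scale[OF g[of n], of "s n (u n) / (3 ^ n * nm (g n))"] gpos[of n]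
    by (simp add: u_Suc s_abs abs_mult power_one_over)
  \<comment> \<open>Geometric sum of the step lengths from \<open>n\<close> on; its total is \<open>3/2 * 3\<^sup>-\<^sup>n\<close>.\<close>
  have tail: "nm (\<lambda>x. u (n + j) x - u n x) \<le> 3/2 * (1/3) ^ n * (1 - (1/3) ^ j)" for n j
  proof (induction j)
    case 0
    then show ?case by (simp add: nm_zero)
  next
    case (Suc j)
    have "nm (\<lambda>x. u (n + Suc j) x - u n x) \<le> (1/3) ^ (n + j) + nm (\<lambda>x. u (n + j) x - u n x)"
      using nm_triangle[OF u[of "Suc (n + j)"] u[of "n + j"] u[of n]] by (simp only: inc add_Suc_right)
    also have "\<dots> \<le> (1/3) ^ (n + j) + 3/2 * (1/3) ^ n * (1 - (1/3) ^ j)" using Suc by simp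
    also have "\<dots> = 3/2 * (1/3) ^ n * (1 - (1/3) ^ Suc j)" by (simp add: power_add field_simps)
    finally show ?case .
  qed
  have tail_le: "nm (\<lambda>x. u m x - u n x) \<le> 3/2 * (1/3) ^ n" if "m \<ge> n" for m n
  proof -
    have "3/2 * (1/3) ^ n * (1 - (1/3) ^ (m - n)) \<le> 3/2 * (1/3::real) ^ n * 1"
      by (intro mult_left_mono) auto
    moreover have "n + (m - n) = m" using that by simp
    then have "nm (\<lambda>x. u m x - u n x) \<le> 3/2 * (1/3) ^ n * (1 - (1/3) ^ (m - n))"
      using tail[of n "m - n"] by (simp only:)
    ultimately show ?thesis by (simp only: mult_1_right)
  qed
  have uC: "u \<in> step_cauchy R T"
  proof (rule step_cauchyI[OF u])
    fix e :: real assume "e > 0"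
    then obtain N where N: "(1/3::real) ^ N < e / 3"
      using real_arch_pow_inv[of "e/3" "1/3"] by auto
    show "\<exists>N. \<forall>m\<ge>N. \<forall>n\<ge>N. nm (\<lambda>x. u m x - u n x) < e"
    proof (intro exI allI impI)
      fix m n assume "m \<ge> N" "n \<ge> N"
      then have "nm (\<lambda>x. u m x - u n x) \<le> 3/2 * (1/3) ^ N + 3/2 * (1/3) ^ N"
        using nm_triangle[OF u[of m] u[of N] u[of n]] nm_commute[OF u[of N] u[of n]]
          tail_le[of N m] tail_le[of N n] by linarith
      then show "nm (\<lambda>x. u m x - u n x) < e" using N by simp
    qed
  qed
  obtain K where K: "\<And>h l. h \<in> V \<Longrightarrow> (\<lambda>n. ip (P h) (u n)) \<longlonglongrightarrow> l \<Longrightarrow> \<bar>l\<bar> \<le> K * nm h"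
    using weak[OF uC] by blast
  have "(4/3) ^ n \<le> 2 * \<bar>K\<bar>" for n
  proof -
    obtain l where l: "(\<lambda>m. ip (g n) (u m)) \<longlonglongrightarrow> l"
      using cauchy_ip_convergent[OF uC g] by (auto simp: convergent_def)
    have kick: "ip (g n) (u (Suc n)) = ip (g n) (u n) + s n (u n) * ((1/3) ^ n * nm (g n))"
      using gpos[of n] unfolding u_Suc step_inner_lincomb[OF u g g] nm_sq[OF g, of n, symmetric]
      by (simp add: power2_eq_square field_simps)
    \<comment> \<open>The sign \<open>s\<close> was chosen so that the two summands do not cancel.\<close>
    have kick_abs: "(1/3) ^ n * nm (g n) \<le> \<bar>ip (g n) (u (Suc n))\<bar>"
    proof -
      have "0 \<le> (1/3) ^ n * nm (g n)" using gpos[of n] by simp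
      then show ?thesis unfolding kick s_def by (auto split: if_splits)
    qed
    have low: "1/2 * (1/3) ^ n * nm (g n) \<le> \<bar>ip (g n) (u m)\<bar>" if "m \<ge> Suc n" for m
    proof -
      have "\<bar>ip (g n) (u m) - ip (g n) (u (Suc n))\<bar> \<le> nm (g n) * nm (\<lambda>x. u m x - u (Suc n) x)"
        using step_Cauchy_Schwarz[OF g step_space_diff[OF u u]] ip_diff[OF u u g] by metis
      also have "\<dots> \<le> nm (g n) * (3/2 * (1/3) ^ Suc n)"
        using tail_le[OF that] gpos[of n] by (intro mult_left_mono) auto
      finally have "\<bar>ip (g n) (u m) - ip (g n) (u (Suc n))\<bar> \<le> 1/2 * (1/3) ^ n * nm (g n)"
        by (simp add: mult.commute)
      then show ?thesis using kick_abs by linarith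
    qed
    have "1/2 * (1/3) ^ n * nm (g n) \<le> \<bar>l\<bar>"
      by (rule LIMSEQ_le_const[OF tendsto_rabs[OF l]]) (use low in blast)
    also have "\<bar>l\<bar> \<le> K * nm (f n)" using K[OF f] l by (simp add: g_def)
    also have "\<dots> \<le> \<bar>K\<bar> * nm (f n)" using nm_nonneg[OF f] by (intro mult_right_mono) auto
    also have "\<dots> \<le> \<bar>K\<bar> * (nm (g n) / 4 ^ n)"
      using big[of n] by (intro mult_left_mono) (auto simp: g_def field_simps)
    finally have "nm (g n) * (1/2 * (1/3) ^ n) \<le> nm (g n) * (\<bar>K\<bar> / 4 ^ n)"
      by (simp add: mult.commute)
    then have "1/2 * (1/3) ^ n \<le> \<bar>K\<bar> / 4 ^ n" using gpos[of n] by (simp only: mult_le_cancel_left_pos)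
    then show ?thesis by (simp add: field_simps)
  qed
  moreover obtain n where "2 * \<bar>K\<bar> < (4/3::real) ^ n" using real_arch_pow[of "4/3"] by auto
  ultimately show False by (meson not_le)
qed

text \<open>A minimizing sequence of \<open>J f = \<parallel>f\<parallel>\<^sup>2 - 2 \<phi> f\<close> represents \<open>\<phi>\<close>. It is Cauchy because \<open>J\<close> at the
  midpoint of two almost minimizers is still at least the infimum, and almost minimality in the
  direction of \<open>f\<close> forces the derivative \<open>2 (\<langle>f, G\<^sub>n\<rangle> - \<phi> f)\<close> to be small.\<close>

lemma riesz_representation:
  assumes lin: "\<And>f g c. f \<in> V \<Longrightarrow> g \<in> V \<Longrightarrow> \<phi> (\<lambda>x. f x + c * g x) = \<phi> f + c * \<phi> g"
    and bd: "\<And>f. f \<in> V \<Longrightarrow> \<bar>\<phi> f\<bar> \<le> C * nm f"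
  shows "\<exists>G\<in>step_cauchy R T. \<forall>f\<in>V. (\<lambda>n. ip f (G n)) \<longlonglongrightarrow> \<phi> f"
proof -
  define J where "J f = (nm f)\<^sup>2 - 2 * \<phi> f" for f
  have "- C\<^sup>2 \<le> J f" if "f \<in> V" for f
    using bd[OF that] zero_le_power2[of "nm f - C"] unfolding J_def power2_diff
    by (simp add: abs_le_iff mult.commute)
  then have bdd: "bdd_below (J ` V)" by (intro bdd_belowI) auto
  define \<mu> where "\<mu> = Inf (J ` V)"
  have \<mu>: "\<mu> \<le> J f" if "f \<in> V" for f unfolding \<mu>_def using bdd that by (simp add: cInf_lower)
  have "\<exists>f\<in>V. J f < \<mu> + 1 / Suc n" for n
    using cInf_lessD[of "J ` V" "\<mu> + 1 / Suc n"] zero_step unfolding \<mu>_def by auto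
  then obtain G where G: "\<And>n. G n \<in> V" and JG: "\<And>n. J (G n) < \<mu> + 1 / Suc n" by metis
  have J_lincomb: "J (\<lambda>x. f x + c * g x) = J f + 2 * c * (ip f g - \<phi> g) + c\<^sup>2 * (nm g)\<^sup>2"
    if "f \<in> V" "g \<in> V" for f g c
    using that by (simp add: J_def nm_lincomb_sq lin algebra_simps)
  \<comment> \<open>Compare \<open>J\<close> at \<open>G m\<close>, at \<open>G n\<close> and at their midpoint.\<close>
  have mid: "(nm (\<lambda>x. G m x - G n x))\<^sup>2 \<le> 2 * (1 / Suc m + 1 / Suc n)" for m n
  proof -
    let ?d = "\<lambda>x. G m x - G n x"
    have d: "?d \<in> V" by (intro step_space_diff G)
    have "J (G m) = J (G n) + 2 * (ip (G n) ?d - \<phi> ?d) + (nm ?d)\<^sup>2"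
      using J_lincomb[OF G d, of n 1] by simp
    moreover have "\<mu> \<le> J (G n) + (ip (G n) ?d - \<phi> ?d) + (nm ?d)\<^sup>2 / 4"
      using J_lincomb[OF G d, of n "1/2"] \<mu>[OF step_space_lincomb(1)[OF G d], of n "1/2"]
      by (simp add: power2_eq_square)
    ultimately show ?thesis using JG[of m] JG[of n] by (simp add: algebra_simps)
  qed
  have "G \<in> step_cauchy R T"
  proof (rule step_cauchyI[OF G])
    fix e :: real assume e: "e > 0"
    then obtain N where N: "1 / Suc N < e\<^sup>2 / 4"
      using reals_Archimedean[of "e\<^sup>2 / 4"] by (auto simp: inverse_eq_divide)
    show "\<exists>N. \<forall>m\<ge>N. \<forall>n\<ge>N. nm (\<lambda>x. G m x - G n x) < e"
    proof (intro exI allI impI)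
      fix m n assume "m \<ge> N" "n \<ge> N"
      then have le: "1 / Suc m \<le> 1 / Suc N" "1 / Suc n \<le> 1 / Suc N" by (auto intro!: divide_left_mono)
      have key: "y < d" if "a \<le> c" "b \<le> c" "y \<le> 2 * (a + b)" "c < d / 4" for a b c d y :: real
        using that by simp
      have "(nm (\<lambda>x. G m x - G n x))\<^sup>2 < e\<^sup>2" by (rule key[OF le mid N])
      then show "nm (\<lambda>x. G m x - G n x) < e" using e by (simp add: power_less_imp_less_base)
    qed
  qed
  moreover have "(\<lambda>n. ip f (G n)) \<longlonglongrightarrow> \<phi> f" if f: "f \<in> V" for f
  proof -
    have bound: "\<bar>ip f (G n) - \<phi> f\<bar> \<le> sqrt (1 / Suc n) * nm f" for n
    proof -
      have "\<bar>ip f (G n) - \<phi> f\<bar> \<le> sqrt (1 / Suc n) * sqrt ((nm f)\<^sup>2)"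
      proof (rule quadratic_nonneg_imp)
        fix t
        show "0 \<le> 1 / Suc n + 2 * t * (ip f (G n) - \<phi> f) + t\<^sup>2 * (nm f)\<^sup>2"
          using \<mu>[OF step_space_lincomb(1)[OF G f], of n t] J_lincomb[OF G f, of n t] JG[of n]
            step_inner_commute[OF f G, of n] by simp
      qed simp
      then show ?thesis using nm_nonneg[OF f] by simp
    qed
    have "(\<lambda>n. sqrt (1 / Suc n) * nm f) \<longlonglongrightarrow> sqrt 0 * nm f"
      by (intro tendsto_intros LIMSEQ_Suc[OF lim_const_over_n])
    then have lim0: "(\<lambda>n. sqrt (1 / Suc n) * nm f) \<longlonglongrightarrow> 0" by simp
    have "(\<lambda>n. ip f (G n) - \<phi> f) \<longlonglongrightarrow> 0"
      by (rule Lim_null_comparison[OF always_eventually lim0]) (simp only: real_norm_def bound simp_thms)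
    then show ?thesis by (simp add: LIM_zero_iff)
  qed
  ultimately show ?thesis by blast
qed

end

section \<open>Completeness of the space of square integrable functions\<close>

lemma L2_diff_integrable:
  fixes Y Z :: "'a \<Rightarrow> real"
  assumes [measurable]: "Y \<in> borel_measurable M" "Z \<in> borel_measurable M"
    and i: "integrable M (\<lambda>\<omega>. (Y \<omega>)\<^sup>2)" "integrable M (\<lambda>\<omega>. (Z \<omega>)\<^sup>2)"
  shows "integrable M (\<lambda>\<omega>. (Y \<omega> - Z \<omega>)\<^sup>2)"
proof (rule Bochner_Integration.integrable_bound)
  show "integrable M (\<lambda>\<omega>. 2 * (Y \<omega>)\<^sup>2 + 2 * (Z \<omega>)\<^sup>2)" using i by simp
  have "(y - z)\<^sup>2 \<le> 2 * y\<^sup>2 + 2 * z\<^sup>2" for y z :: real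
    using zero_le_power2[of "y + z"] by (simp add: power2_diff power2_sum)
  then show "AE \<omega> in M. norm ((Y \<omega> - Z \<omega>)\<^sup>2) \<le> norm (2 * (Y \<omega>)\<^sup>2 + 2 * (Z \<omega>)\<^sup>2)" by simp
qed measurable

lemma L2_dist_sq: "(L2_dist M Y Z)\<^sup>2 = (\<integral>\<omega>. (Y \<omega> - Z \<omega>)\<^sup>2 \<partial>M)"
  by (simp add: L2_dist_def)

lemma L2_dist_nonneg: "0 \<le> L2_dist M Y Z" by (simp add: L2_dist_def)

lemma Cauchy_Schwarz_integral:
  fixes Y Z :: "'a \<Rightarrow> real"
  assumes [measurable]: "Y \<in> borel_measurable M" "Z \<in> borel_measurable M"
    and i: "integrable M (\<lambda>\<omega>. (Y \<omega>)\<^sup>2)" "integrable M (\<lambda>\<omega>. (Z \<omega>)\<^sup>2)"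
      "integrable M (\<lambda>\<omega>. Y \<omega> * Z \<omega>)"
  shows "\<bar>\<integral>\<omega>. Y \<omega> * Z \<omega> \<partial>M\<bar> \<le> sqrt (\<integral>\<omega>. (Y \<omega>)\<^sup>2 \<partial>M) * sqrt (\<integral>\<omega>. (Z \<omega>)\<^sup>2 \<partial>M)"
proof (rule quadratic_nonneg_imp)
  fix t
  have "0 \<le> (\<integral>\<omega>. (Y \<omega> + t * Z \<omega>)\<^sup>2 \<partial>M)" by simp
  also have "\<dots> = (\<integral>\<omega>. (Y \<omega>)\<^sup>2 + 2 * t * (Y \<omega> * Z \<omega>) + t\<^sup>2 * (Z \<omega>)\<^sup>2 \<partial>M)"
    by (intro Bochner_Integration.integral_cong refl) (simp add: power2_eq_square algebra_simps)
  also have "\<dots> = (\<integral>\<omega>. (Y \<omega>)\<^sup>2 \<partial>M) + 2 * t * (\<integral>\<omega>. Y \<omega> * Z \<omega> \<partial>M) + t\<^sup>2 * (\<integral>\<omega>. (Z \<omega>)\<^sup>2 \<partial>M)"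
    using i by simp
  finally show "0 \<le> (\<integral>\<omega>. (Y \<omega>)\<^sup>2 \<partial>M) + 2 * t * (\<integral>\<omega>. Y \<omega> * Z \<omega> \<partial>M) + t\<^sup>2 * (\<integral>\<omega>. (Z \<omega>)\<^sup>2 \<partial>M)" .
qed simp

context prob_space
begin

lemma L1_le_L2:
  fixes Y Z :: "'a \<Rightarrow> real"
  assumes [measurable]: "Y \<in> borel_measurable M" "Z \<in> borel_measurable M"
    and i: "integrable M (\<lambda>\<omega>. (Y \<omega> - Z \<omega>)\<^sup>2)"
  shows "(\<integral>\<^sup>+\<omega>. ennreal \<bar>Y \<omega> - Z \<omega>\<bar> \<partial>M) \<le> ennreal (L2_dist M Y Z)"
proof -
  have a: "integrable M (\<lambda>\<omega>. \<bar>Y \<omega> - Z \<omega>\<bar>)"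
    using square_integrable_imp_integrable[of "\<lambda>\<omega>. Y \<omega> - Z \<omega>"] i by simp
  have "\<bar>\<integral>\<omega>. \<bar>Y \<omega> - Z \<omega>\<bar> * 1 \<partial>M\<bar> \<le> sqrt (\<integral>\<omega>. \<bar>Y \<omega> - Z \<omega>\<bar>\<^sup>2 \<partial>M) * sqrt (\<integral>\<omega>. 1\<^sup>2 \<partial>M)"
    using a i by (intro Cauchy_Schwarz_integral) auto
  then have "(\<integral>\<omega>. \<bar>Y \<omega> - Z \<omega>\<bar> \<partial>M) \<le> L2_dist M Y Z" by (simp add: L2_dist_def prob_space)
  then show ?thesis using a by (subst nn_integral_eq_integral) (auto intro: ennreal_leI)
qed

text \<open>A subsequence with distances below \<open>2\<^sup>-\<^sup>k\<close> has increments that are absolutely summable almost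
  surely, since their first moments are summable. Its pointwise limit is measurable for the
  sub-\<open>\<sigma>\<close>-algebra, and Fatou's lemma bounds the distance of this limit to the sequence.\<close>

lemma L2_complete:
  fixes Y :: "nat \<Rightarrow> 'a \<Rightarrow> real"
  assumes sub: "subalgebra M N"
    and mN: "\<And>n. Y n \<in> borel_measurable N"
    and i: "\<And>n. integrable M (\<lambda>\<omega>. (Y n \<omega>)\<^sup>2)"
    and Cauchy: "\<And>e. e > 0 \<Longrightarrow> \<exists>n0. \<forall>m\<ge>n0. \<forall>n\<ge>n0. L2_dist M (Y m) (Y n) < e"
  obtains h where "h \<in> borel_measurable N" "integrable M (\<lambda>\<omega>. (h \<omega>)\<^sup>2)"
    "(\<lambda>n. L2_dist M h (Y n)) \<longlonglongrightarrow> 0"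
proof -
  have [measurable]: "Y n \<in> borel_measurable M" for n
    by (rule measurable_from_subalg[OF sub mN])
  have "\<exists>n0. \<forall>m\<ge>n0. \<forall>n\<ge>n0. L2_dist M (Y m) (Y n) < (1/2) ^ k" for k :: nat
    by (rule Cauchy) simp
  then obtain n0 where n0: "\<And>k m n. m \<ge> n0 k \<Longrightarrow> n \<ge> n0 k \<Longrightarrow> L2_dist M (Y m) (Y n) < (1/2) ^ k"
    by metis
  \<comment> \<open>Monotone majorant of \<open>n0\<close>, so that two consecutive indices both lie beyond \<open>n0 k\<close>; the summand \<open>k\<close> makes it tend to infinity.\<close>
  define s where "s k = (\<Sum>j\<le>k. n0 j) + k" for k
  have s_ge: "s k \<ge> n0 k" "s (Suc k) \<ge> n0 k" "s k \<ge> k" for k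
    using member_le_sum[of k "{..k}" n0] by (auto simp: s_def)
  define Z where "Z k = Y (s k)" for k
  have [measurable]: "Z k \<in> borel_measurable M" for k by (simp add: Z_def)
  have diff: "integrable M (\<lambda>\<omega>. (Y m \<omega> - Y n \<omega>)\<^sup>2)" for m n by (intro L2_diff_integrable i) auto
  have "(\<integral>\<^sup>+\<omega>. (\<Sum>k. ennreal \<bar>Z (Suc k) \<omega> - Z k \<omega>\<bar>) \<partial>M)
      = (\<Sum>k. \<integral>\<^sup>+\<omega>. ennreal \<bar>Z (Suc k) \<omega> - Z k \<omega>\<bar> \<partial>M)"
    by (intro nn_integral_suminf) auto
  also have "\<dots> \<le> (\<Sum>k. ennreal ((1/2) ^ k))"
  proof (intro suminf_le summableI)
    fix k
    have "(\<integral>\<^sup>+\<omega>. ennreal \<bar>Z (Suc k) \<omega> - Z k \<omega>\<bar> \<partial>M) \<le> ennreal (L2_dist M (Z (Suc k)) (Z k))"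
      unfolding Z_def by (intro L1_le_L2 diff) auto
    also have "\<dots> \<le> ennreal ((1/2) ^ k)"
      unfolding Z_def using n0[OF s_ge(2,1)[of k]] by (intro ennreal_leI) auto
    finally show "(\<integral>\<^sup>+\<omega>. ennreal \<bar>Z (Suc k) \<omega> - Z k \<omega>\<bar> \<partial>M) \<le> ennreal ((1/2) ^ k)" .
  qed
  also have "\<dots> < \<top>"
    by (subst suminf_ennreal2) (auto intro: summable_geometric)
  finally have "AE \<omega> in M. (\<Sum>k. ennreal \<bar>Z (Suc k) \<omega> - Z k \<omega>\<bar>) \<noteq> \<infinity>"
    by (intro nn_integral_PInf_AE) (auto simp: less_top)
  then have conv: "AE \<omega> in M. convergent (\<lambda>k. Z k \<omega>)"
  proof eventually_elim
    case (elim \<omega>)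
    then have "summable (\<lambda>k. \<bar>Z (Suc k) \<omega> - Z k \<omega>\<bar>)"
      by (intro summable_suminf_not_top) (auto simp: top_ennreal_def)
    then have "summable (\<lambda>k. Z (Suc k) \<omega> - Z k \<omega>)" by (rule summable_rabs_cancel)
    then have "convergent (\<lambda>n. (\<Sum>k<n. Z (Suc k) \<omega> - Z k \<omega>) + Z 0 \<omega>)"
      by (intro convergent_add convergent_const) (simp add: summable_iff_convergent)
    moreover have "(\<Sum>k<n. Z (Suc k) \<omega> - Z k \<omega>) + Z 0 \<omega> = Z n \<omega>" for n
      using sum_lessThan_telescope[of "\<lambda>k. Z k \<omega>" n] by simp
    ultimately show ?case by simp
  qed
  define h where "h \<omega> = lim (\<lambda>k. Z k \<omega>)" for \<omega>
  have hN: "h \<in> borel_measurable N"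
    unfolding h_def[abs_def] by (rule borel_measurable_lim_metric) (simp add: Z_def mN)
  have [measurable]: "h \<in> borel_measurable M" by (rule measurable_from_subalg[OF sub hN])
  have fatou: "(\<integral>\<^sup>+\<omega>. ennreal ((h \<omega> - Y m \<omega>)\<^sup>2) \<partial>M) \<le> ennreal (((1/2) ^ k)\<^sup>2)"
    if m: "m \<ge> n0 k" for m k
  proof -
    have "(\<integral>\<^sup>+\<omega>. ennreal ((h \<omega> - Y m \<omega>)\<^sup>2) \<partial>M)
        = (\<integral>\<^sup>+\<omega>. liminf (\<lambda>j. ennreal ((Z j \<omega> - Y m \<omega>)\<^sup>2)) \<partial>M)"
      using conv
    proof (intro nn_integral_cong_AE, eventually_elim)
      case (elim \<omega>)
      then have "(\<lambda>j. Z j \<omega>) \<longlonglongrightarrow> h \<omega>" by (simp add: h_def convergent_LIMSEQ_iff)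
      then have "(\<lambda>j. ennreal ((Z j \<omega> - Y m \<omega>)\<^sup>2)) \<longlonglongrightarrow> ennreal ((h \<omega> - Y m \<omega>)\<^sup>2)"
        by (intro tendsto_intros)
      from lim_imp_Liminf[OF _ this] show ?case by simp
    qed
    also have "\<dots> \<le> liminf (\<lambda>j. \<integral>\<^sup>+\<omega>. ennreal ((Z j \<omega> - Y m \<omega>)\<^sup>2) \<partial>M)"
      by (rule nn_integral_liminf) auto
    also have "\<dots> \<le> liminf (\<lambda>j. ennreal (((1/2) ^ k)\<^sup>2))"
    proof (intro Liminf_mono eventually_sequentiallyI)
      fix j assume "j \<ge> n0 k"
      then have "s j \<ge> n0 k" using s_ge(3)[of j] by simp
      then have "L2_dist M (Y (s j)) (Y m) < (1/2) ^ k" using m by (intro n0)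
      then have "(\<integral>\<omega>. (Z j \<omega> - Y m \<omega>)\<^sup>2 \<partial>M) \<le> ((1/2) ^ k)\<^sup>2"
        unfolding Z_def L2_dist_sq[symmetric] using L2_dist_nonneg by (intro power_mono) auto
      then show "(\<integral>\<^sup>+\<omega>. ennreal ((Z j \<omega> - Y m \<omega>)\<^sup>2) \<partial>M) \<le> ennreal (((1/2) ^ k)\<^sup>2)"
        using diff unfolding Z_def by (subst nn_integral_eq_integral) (auto intro: ennreal_leI)
    qed
    also have "\<dots> = ennreal (((1/2) ^ k)\<^sup>2)" by (simp add: Liminf_const)
    finally show ?thesis .
  qed
  have int: "integrable M (\<lambda>\<omega>. (h \<omega> - Y m \<omega>)\<^sup>2)" if "m \<ge> n0 k" for m k
    using fatou[OF that] by (intro integrableI_bounded) (auto simp: order_le_less_trans)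
  have dist: "L2_dist M h (Y m) \<le> (1/2) ^ k" if "m \<ge> n0 k" for m k
  proof -
    have "ennreal (\<integral>\<omega>. (h \<omega> - Y m \<omega>)\<^sup>2 \<partial>M) \<le> ennreal (((1/2) ^ k)\<^sup>2)"
      using fatou[OF that] int[OF that] by (subst (asm) nn_integral_eq_integral) auto
    then have "(L2_dist M h (Y m))\<^sup>2 \<le> ((1/2) ^ k)\<^sup>2"
      by (simp add: L2_dist_sq)
    then show ?thesis by (rule power2_le_imp_le) simp
  qed
  \<comment> \<open>Finite distance to one member of the sequence suffices.\<close>
  have "integrable M (\<lambda>\<omega>. (h \<omega>)\<^sup>2)"
  proof -
    have a: "integrable M (\<lambda>\<omega>. (Y (n0 0) \<omega> - h \<omega>)\<^sup>2)"
      using int[OF order_refl[of "n0 0"]] by (simp add: power2_commute)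
    have "integrable M (\<lambda>\<omega>. ((Y (n0 0) \<omega> - h \<omega>) - Y (n0 0) \<omega>)\<^sup>2)"
      by (rule L2_diff_integrable[OF _ _ a i]) auto
    then show ?thesis by simp
  qed
  moreover have "(\<lambda>n. L2_dist M h (Y n)) \<longlonglongrightarrow> 0"
  proof (rule LIMSEQ_I)
    fix e :: real assume "e > 0"
    then obtain k where "(1/2::real) ^ k < e" using real_arch_pow_inv[of e "1/2"] by auto
    then show "\<exists>no. \<forall>n\<ge>no. norm (L2_dist M h (Y n) - 0) < e"
      unfolding diff_0_right real_norm_def abs_of_nonneg[OF L2_dist_nonneg]
      using dist[of k] by (intro exI[of _ "n0 k"]) (auto intro: order_le_less_trans)
  qed
  ultimately show ?thesis using that hN by blast
qed

end

section \<open>Cameron-Martin functions as limits along Cauchy sequences\<close>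

context centered_gaussian_process
begin

lemma process_sigma_simps:
  "space (process_sigma M T X) = space M"
  "sets (process_sigma M T X) =
     sigma_sets (space M) {X s -` B \<inter> space M | s B. s \<in> {0..T} \<and> B \<in> sets borel}"
  unfolding process_sigma_def by (subst space_measure_of sets_measure_of; blast)+

lemma subalgebra_process: "subalgebra M (process_sigma M T X)"
proof -
  have "{X s -` B \<inter> space M | s B. s \<in> {0..T} \<and> B \<in> sets borel} \<subseteq> sets M"
    using process_rv(1) by (auto intro: measurable_sets)
  then show ?thesis
    unfolding subalgebra_def process_sigma_simps using sets.sigma_sets_subset by blast
qed

lemma process_measurable:
  assumes "s \<in> {0..T}" shows "X s \<in> borel_measurable (process_sigma M T X)"
proof (rule measurableI)
  fix B :: "real set" assume "B \<in> sets borel"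
  then show "X s -` B \<inter> space (process_sigma M T X) \<in> sets (process_sigma M T X)"
    using assms unfolding process_sigma_simps by (intro sigma_sets.Basic) auto
qed auto

lemma step_rv_measurable:
  assumes "f \<in> V" shows "step_rv f \<in> borel_measurable (process_sigma M T X)"
proof -
  have "step_coeff f t \<noteq> 0 \<Longrightarrow> X t \<in> borel_measurable (process_sigma M T X)" for t
    using step_coeff_support(2)[OF assms] by (intro process_measurable) auto
  then show ?thesis
    unfolding step_rv_def[abs_def] by (intro borel_measurable_sum borel_measurable_times) auto
qed

lemma step_rv_in_span: "f \<in> V \<Longrightarrow> step_rv f \<in> process_span T X"
  using step_coeff_support[of f T] unfolding step_rv_def[abs_def] process_span_def by blast

lemma span_step_rv:
  assumes "g \<in> process_span T X"
  obtains f where "f \<in> V" "AE \<omega> in M. step_rv f \<omega> = g \<omega>"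
proof -
  obtain S c where S: "finite S" "S \<subseteq> {0..T}" and g: "g = (\<lambda>\<omega>. \<Sum>s\<in>S. c s * X s \<omega>)"
    using assms by (auto simp: process_span_def)
  have S0: "S \<subseteq> {0..}" using S by auto
  have "AE \<omega> in M. step_rv (step_comb S c) \<omega> = g \<omega>"
    using start_zero
  proof eventually_elim
    case (elim \<omega>)
    show ?case unfolding step_rv_def g step_coeff_comb[OF S(1) S0]
      by (rule sum.mono_neutral_cong_left[OF S(1)])
         (use elim S0 in \<open>auto simp: less_le split: if_splits\<close>)
  qed
  moreover have "step_comb S c \<in> V" using S by (auto simp: step_space_def)
  ultimately show ?thesis using that by blast
qed

lemma step_norm_dist:
  assumes "f \<in> V" "g \<in> V" shows "nm (\<lambda>x. f x - g x) = L2_dist M (step_rv f) (step_rv g)"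
  using step_norm_eq[OF step_space_diff[OF assms]] step_rv_lincomb[OF assms, of "-1"]
  by (simp add: L2_dist_def)

text \<open>The limit of the images of a Cauchy sequence of step functions represents the weak limit of that
  sequence; this is the link between first chaos and completion.\<close>

lemma step_inner_tendsto_expectation:
  assumes F: "\<And>n. F n \<in> V" and h[measurable]: "h \<in> borel_measurable M" and hi: "integrable M (\<lambda>\<omega>. (h \<omega>)\<^sup>2)"
    and lim: "(\<lambda>n. L2_dist M h (step_rv (F n))) \<longlonglongrightarrow> 0" and f: "f \<in> V"
  shows "(\<lambda>n. ip f (F n)) \<longlonglongrightarrow> (\<integral>\<omega>. step_rv f \<omega> * h \<omega> \<partial>M)"
proof -
  note [measurable] = step_rv(1)[OF F] step_rv(1)[OF f]
  have bound: "\<bar>(\<integral>\<omega>. step_rv f \<omega> * h \<omega> \<partial>M) - ip f (F n)\<bar> \<le> nm f * L2_dist M h (step_rv (F n))" for n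
  proof -
    have d: "integrable M (\<lambda>\<omega>. (h \<omega> - step_rv (F n) \<omega>)\<^sup>2)"
      by (intro L2_diff_integrable hi step_rv F) auto
    have "(\<integral>\<omega>. step_rv f \<omega> * h \<omega> \<partial>M) - ip f (F n) = (\<integral>\<omega>. step_rv f \<omega> * (h \<omega> - step_rv (F n) \<omega>) \<partial>M)"
      unfolding step_inner_eq[OF f F] right_diff_distrib
      by (rule Bochner_Integration.integral_diff[symmetric])
         (intro integrable_prod step_rv f F h hi)+
    also have "\<bar>\<dots>\<bar> \<le> nm f * L2_dist M h (step_rv (F n))"
      unfolding step_norm_eq[OF f] L2_dist_def
      by (intro Cauchy_Schwarz_integral integrable_prod step_rv f d) auto
    finally show ?thesis .
  qed
  have lim0: "(\<lambda>n. nm f * L2_dist M h (step_rv (F n))) \<longlonglongrightarrow> 0"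
    using tendsto_mult_right_zero[OF lim] .
  have "(\<lambda>n. (\<integral>\<omega>. step_rv f \<omega> * h \<omega> \<partial>M) - ip f (F n)) \<longlonglongrightarrow> 0"
    by (rule Lim_null_comparison[OF always_eventually lim0]) (simp only: real_norm_def bound simp_thms)
  from tendsto_diff[OF tendsto_const[of "\<integral>\<omega>. step_rv f \<omega> * h \<omega> \<partial>M"] this] show ?thesis by simp
qed

text \<open>The equality is only almost sure: the indicator of \<open>(0,0]\<close> is zero, while \<open>X 0\<close> vanishes
  almost surely.\<close>

lemma step_rv_indicator:
  assumes "t \<in> {0..T}" shows "AE \<omega> in M. step_rv (indicator {0<..t}) \<omega> = X t \<omega>"
  using start_zero
proof eventually_elim
  case (elim \<omega>)
  have c: "step_coeff (step_comb {t} (\<lambda>_. 1)) = (\<lambda>u. if u = t \<and> 0 < u then 1 else 0)"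
    using assms by (subst step_coeff_comb) auto
  show ?case
  proof (cases "t = 0")
    case True
    have "{u. (if u = t \<and> 0 < u then 1 else 0 :: real) \<noteq> 0} = {}" using True by auto
    then show ?thesis using True elim unfolding step_rv_def indicator_eq_step_comb c by simp
  next
    case False
    then have "{u. (if u = t \<and> 0 < u then 1 else 0 :: real) \<noteq> 0} = {t}" using assms by auto
    then show ?thesis using False assms unfolding step_rv_def indicator_eq_step_comb c by simp
  qed
qed

lemma cm_value:
  assumes "t \<in> {0..T}" "h \<in> borel_measurable M"
  shows "(\<integral>\<omega>. step_rv (indicator {0<..t}) \<omega> * h \<omega> \<partial>M) = (\<integral>\<omega>. X t \<omega> * h \<omega> \<partial>M)"
  using step_rv_indicator[OF assms(1)] process_rv(1)[OF assms(1)] assms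
    step_rv(1)[OF indicator_step[OF assms(1)]]
  by (intro integral_cong_AE) auto

text \<open>The map \<open>f \<mapsto> step_rv f\<close> is an isometry of the step functions onto the span of the process, up to
  almost sure equality. Hence an element of the first chaos is approximated by step functions which
  form a Cauchy sequence, and a Cauchy sequence of step functions produces an element of the first
  chaos by completeness.\<close>

lemma cameron_martin_iff:
  "u \<in> cameron_martin M T X \<longleftrightarrow> u \<in> extensional {0..T} \<and>
     (\<exists>F\<in>step_cauchy R T. \<forall>t\<in>{0..T}. (\<lambda>n. ip (indicator {0<..t}) (F n)) \<longlonglongrightarrow> u t)"
proof (intro iffI conjI; (elim conjE bexE)?)
  assume "u \<in> cameron_martin M T X"
  then obtain h where h: "h \<in> first_chaos M T X" and u: "u = cm_function M T X h"
    by (auto simp: cameron_martin_def)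
  show "u \<in> extensional {0..T}" by (simp add: u cm_function_def)
  have hm[measurable]: "h \<in> borel_measurable M" and hi: "integrable M (\<lambda>\<omega>. (h \<omega>)\<^sup>2)"
    using h measurable_from_subalg[OF subalgebra_process] by (auto simp: first_chaos_def L2_process_def)
  have "\<exists>f\<in>V. L2_dist M h (step_rv f) < 1 / Suc n" for n
  proof -
    obtain g where g: "g \<in> process_span T X" "L2_dist M h g < 1 / Suc n"
    proof -
      have "\<forall>e>0. \<exists>g\<in>process_span T X. L2_dist M h g < e" using h by (simp add: first_chaos_def)
      moreover have "0 < 1 / real (Suc n)" by simp
      ultimately show ?thesis using that by blast
    qed
    obtain f where f: "f \<in> V" "AE \<omega> in M. step_rv f \<omega> = g \<omega>" using span_step_rv[OF g(1)] by blast
    have [measurable]: "g \<in> borel_measurable M"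
      using g(1) process_rv(1) by (auto simp: process_span_def intro!: borel_measurable_sum borel_measurable_times)
    have "(\<integral>\<omega>. (h \<omega> - step_rv f \<omega>)\<^sup>2 \<partial>M) = (\<integral>\<omega>. (h \<omega> - g \<omega>)\<^sup>2 \<partial>M)"
      using f(2) step_rv(1)[OF f(1)] by (intro integral_cong_AE) auto
    then have "L2_dist M h (step_rv f) < 1 / Suc n" using g(2) by (simp only: L2_dist_def)
    then show ?thesis using f(1) by blast
  qed
  then obtain F where F: "\<And>n. F n \<in> V" and Fh: "\<And>n. L2_dist M h (step_rv (F n)) < 1 / Suc n"
    by metis
  note [measurable] = step_rv(1)[OF F]
  have lim: "(\<lambda>n. L2_dist M h (step_rv (F n))) \<longlonglongrightarrow> 0"
  proof (rule Lim_null_comparison)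
    show "\<forall>\<^sub>F n in sequentially. norm (L2_dist M h (step_rv (F n))) \<le> 1 / real (Suc n)"
      unfolding real_norm_def abs_of_nonneg[OF L2_dist_nonneg]
      using less_imp_le[OF Fh] by (intro always_eventually allI)
  qed (rule LIMSEQ_Suc[OF lim_const_over_n])
  have tri: "(nm (\<lambda>x. F m x - F n x))\<^sup>2 \<le>
      2 * (L2_dist M h (step_rv (F m)))\<^sup>2 + 2 * (L2_dist M h (step_rv (F n)))\<^sup>2" for m n
  proof -
    have d: "integrable M (\<lambda>\<omega>. (h \<omega> - step_rv (F n) \<omega>)\<^sup>2)" for n
      by (intro L2_diff_integrable hi step_rv F) auto
    have pw: "(a - b)\<^sup>2 \<le> 2 * (c - a)\<^sup>2 + 2 * (c - b)\<^sup>2" for a b c :: real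
      using zero_le_power2[of "(c - a) + (c - b)"] by (simp add: power2_eq_square algebra_simps)
    have "(nm (\<lambda>x. F m x - F n x))\<^sup>2 = (\<integral>\<omega>. (step_rv (F m) \<omega> - step_rv (F n) \<omega>)\<^sup>2 \<partial>M)"
      by (simp add: step_norm_dist F L2_dist_sq)
    also have "\<dots> \<le> (\<integral>\<omega>. 2 * (h \<omega> - step_rv (F m) \<omega>)\<^sup>2 + 2 * (h \<omega> - step_rv (F n) \<omega>)\<^sup>2 \<partial>M)"
      using d pw by (intro integral_mono L2_diff_integrable step_rv F) auto
    also have "\<dots> = 2 * (L2_dist M h (step_rv (F m)))\<^sup>2 + 2 * (L2_dist M h (step_rv (F n)))\<^sup>2"
      using d by (simp add: L2_dist_sq)
    finally show ?thesis .
  qed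
  have "F \<in> step_cauchy R T"
  proof (rule step_cauchyI[OF F])
    fix e :: real assume e: "e > 0"
    then obtain N where N: "\<And>n. n \<ge> N \<Longrightarrow> L2_dist M h (step_rv (F n)) < e / 2"
      using LIMSEQ_D[OF lim, of "e/2"] e
      unfolding diff_0_right real_norm_def abs_of_nonneg[OF L2_dist_nonneg] by auto
    show "\<exists>N. \<forall>m\<ge>N. \<forall>n\<ge>N. nm (\<lambda>x. F m x - F n x) < e"
    proof (intro exI allI impI)
      fix m n assume "m \<ge> N" "n \<ge> N"
      then have "(L2_dist M h (step_rv (F m)))\<^sup>2 < (e/2)\<^sup>2" "(L2_dist M h (step_rv (F n)))\<^sup>2 < (e/2)\<^sup>2"
        using N L2_dist_nonneg by (auto intro!: power_strict_mono)
      then have "(nm (\<lambda>x. F m x - F n x))\<^sup>2 < e\<^sup>2"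
        using tri[of m n] by (simp add: power_divide)
      then show "nm (\<lambda>x. F m x - F n x) < e" using e by (simp add: power_less_imp_less_base)
    qed
  qed
  moreover have "(\<lambda>n. ip (indicator {0<..t}) (F n)) \<longlonglongrightarrow> u t" if "t \<in> {0..T}" for t
    using step_inner_tendsto_expectation[OF F hm hi lim indicator_step[OF that]] that
    by (simp add: cm_value[OF that hm] u cm_function_def)
  ultimately show "\<exists>F\<in>step_cauchy R T. \<forall>t\<in>{0..T}. (\<lambda>n. ip (indicator {0<..t}) (F n)) \<longlonglongrightarrow> u t"
    by blast
next
  fix F assume u: "u \<in> extensional {0..T}" and F: "F \<in> step_cauchy R T"
    and lim: "\<forall>t\<in>{0..T}. (\<lambda>n. ip (indicator {0<..t}) (F n)) \<longlonglongrightarrow> u t"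
  note FV = step_cauchyD(1)[OF F]
  obtain h where hN: "h \<in> borel_measurable (process_sigma M T X)"
    and hi: "integrable M (\<lambda>\<omega>. (h \<omega>)\<^sup>2)" and lh: "(\<lambda>n. L2_dist M h (step_rv (F n))) \<longlonglongrightarrow> 0"
  proof (rule L2_complete[OF subalgebra_process step_rv_measurable[OF FV] step_rv(2)[OF FV]])
    show "\<exists>n0. \<forall>m\<ge>n0. \<forall>n\<ge>n0. L2_dist M (step_rv (F m)) (step_rv (F n)) < e" if "e > 0" for e
      using step_cauchyD(2)[OF F that] by (simp add: step_norm_dist FV)
  qed
  have hm: "h \<in> borel_measurable M" by (rule measurable_from_subalg[OF subalgebra_process hN])
  have "\<exists>g\<in>process_span T X. L2_dist M h g < e" if e: "e > 0" for e
  proof -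
    obtain n where "L2_dist M h (step_rv (F n)) < e"
      using LIMSEQ_D[OF lh e]
      unfolding diff_0_right real_norm_def abs_of_nonneg[OF L2_dist_nonneg] by auto
    then show ?thesis using step_rv_in_span[OF FV] by blast
  qed
  then have h: "h \<in> first_chaos M T X" by (simp add: first_chaos_def L2_process_def hN hi)
  have "u t = (\<integral>\<omega>. X t \<omega> * h \<omega> \<partial>M)" if "t \<in> {0..T}" for t
    using LIMSEQ_unique[OF lim[rule_format, OF that] step_inner_tendsto_expectation[OF FV hm hi lh indicator_step[OF that]]]
    by (simp add: cm_value[OF that hm])
  then have "u = cm_function M T X h"
    unfolding cm_function_def by (intro extensionalityI[OF u]) auto
  then show "u \<in> cameron_martin M T X" using h by (auto simp: cameron_martin_def)
qed

end

section \<open>Integrands as classes of Cauchy sequences\<close>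

context centered_gaussian_process
begin

abbreviation "CS \<equiv> step_cauchy R T"

definition integrand_class :: "(nat \<Rightarrow> real \<Rightarrow> real) \<Rightarrow> integrand" where
  "integrand_class F = step_rel R T `` {F}"

lemma step_rel_iff:
  "(F, G) \<in> step_rel R T \<longleftrightarrow> F \<in> CS \<and> G \<in> CS \<and> (\<lambda>n. nm (\<lambda>x. F n x - G n x)) \<longlonglongrightarrow> 0"
  by (simp add: step_rel_def)

lemma null_squeeze:
  assumes "\<And>n. H n \<in> V" "\<And>n. nm (H n) \<le> b n" "b \<longlonglongrightarrow> 0"
  shows "(\<lambda>n. nm (H n)) \<longlonglongrightarrow> 0"
  using assms nm_nonneg by (intro Lim_null_comparison[OF always_eventually assms(3)]) auto

lemma step_rel_refl: "F \<in> CS \<Longrightarrow> (F, F) \<in> step_rel R T"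
  by (simp add: step_rel_iff nm_zero)

lemma step_rel_sym: "(F, G) \<in> step_rel R T \<Longrightarrow> (G, F) \<in> step_rel R T"
  using nm_commute[OF step_cauchyD(1) step_cauchyD(1), of F G] by (simp add: step_rel_iff)

lemma step_rel_trans:
  assumes "(F, G) \<in> step_rel R T" "(G, H) \<in> step_rel R T"
  shows "(F, H) \<in> step_rel R T"
proof -
  have C: "F \<in> CS" "G \<in> CS" "H \<in> CS"
    and lim: "(\<lambda>n. nm (\<lambda>x. F n x - G n x)) \<longlonglongrightarrow> 0" "(\<lambda>n. nm (\<lambda>x. G n x - H n x)) \<longlonglongrightarrow> 0"
    using assms by (auto simp: step_rel_iff)
  have "(\<lambda>n. nm (\<lambda>x. F n x - H n x)) \<longlonglongrightarrow> 0"
  proof (rule null_squeeze)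
    show "nm (\<lambda>x. F n x - H n x) \<le> nm (\<lambda>x. F n x - G n x) + nm (\<lambda>x. G n x - H n x)" for n
      by (intro nm_triangle step_cauchyD(1) C)
    show "(\<lambda>n. nm (\<lambda>x. F n x - G n x) + nm (\<lambda>x. G n x - H n x)) \<longlonglongrightarrow> 0"
      using tendsto_add[OF lim] by simp
  qed (intro step_space_diff step_cauchyD(1) C)
  then show ?thesis using C by (simp add: step_rel_iff)
qed

lemma integrand_class_eqI: "(F, G) \<in> step_rel R T \<Longrightarrow> integrand_class F = integrand_class G"
  unfolding integrand_class_def using step_rel_sym step_rel_trans by blast

lemma rep_integrand_class:
  assumes "F \<in> CS"
  shows "(F, integrand_rep (integrand_class F)) \<in> step_rel R T" "integrand_rep (integrand_class F) \<in> CS"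
proof -
  have "integrand_rep (integrand_class F) \<in> integrand_class F"
    unfolding integrand_rep_def
    by (rule someI[of "\<lambda>G. G \<in> integrand_class F" F]) (simp add: integrand_class_def step_rel_refl assms)
  then show "(F, integrand_rep (integrand_class F)) \<in> step_rel R T" by (simp add: integrand_class_def)
  then show "integrand_rep (integrand_class F) \<in> CS" by (simp add: step_rel_iff)
qed

lemma integrands_iff: "A \<in> integrands R T \<longleftrightarrow> (\<exists>F\<in>CS. A = integrand_class F)"
  by (auto simp: integrands_def quotient_def integrand_class_def)

lemma diff_lincomb:
  fixes f g f' g' :: "real \<Rightarrow> real"
  shows "(\<lambda>x. (f x + c * g x) - (f' x + c * g' x)) = (\<lambda>x. (f x - f' x) + c * (g x - g' x))"
  by (auto simp: algebra_simps)

lemma nm_diff_lincomb_le: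
  assumes "f \<in> V" "g \<in> V" "f' \<in> V" "g' \<in> V"
  shows "nm (\<lambda>x. (f x + c * g x) - (f' x + c * g' x))
    \<le> nm (\<lambda>x. f x - f' x) + \<bar>c\<bar> * nm (\<lambda>x. g x - g' x)"
  unfolding diff_lincomb by (intro nm_lincomb_le step_space_diff assms)

lemma step_cauchy_lincomb:
  assumes F: "F \<in> CS" and G: "G \<in> CS"
  shows "(\<lambda>n x. F n x + c * G n x) \<in> CS"
proof (rule step_cauchyI)
  show "(\<lambda>x. F n x + c * G n x) \<in> V" for n by (intro step_space_lincomb(1) step_cauchyD(1) F G)
  fix e :: real assume e: "e > 0"
  obtain N1 where N1: "\<And>m n. m \<ge> N1 \<Longrightarrow> n \<ge> N1 \<Longrightarrow> nm (\<lambda>x. F m x - F n x) < e / 2"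
    using step_cauchyD(2)[OF F, of "e/2"] e by auto
  obtain N2 where N2: "\<And>m n. m \<ge> N2 \<Longrightarrow> n \<ge> N2 \<Longrightarrow> nm (\<lambda>x. G m x - G n x) < e / (2 * (\<bar>c\<bar> + 1))"
    using step_cauchyD(2)[OF G, of "e / (2 * (\<bar>c\<bar> + 1))"] e by auto
  show "\<exists>N. \<forall>m\<ge>N. \<forall>n\<ge>N. nm (\<lambda>x. (F m x + c * G m x) - (F n x + c * G n x)) < e"
  proof (intro exI allI impI)
    fix m n assume mn: "m \<ge> max N1 N2" "n \<ge> max N1 N2"
    have "\<bar>c\<bar> * nm (\<lambda>x. G m x - G n x) \<le> (\<bar>c\<bar> + 1) * (e / (2 * (\<bar>c\<bar> + 1)))"
      using N2[of m n] mn nm_nonneg[OF step_space_diff[OF step_cauchyD(1)[OF G] step_cauchyD(1)[OF G]]]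
      by (intro mult_mono) auto
    also have "\<dots> = e / 2" by (simp add: field_simps)
    finally show "nm (\<lambda>x. (F m x + c * G m x) - (F n x + c * G n x)) < e"
      using nm_diff_lincomb_le[OF step_cauchyD(1)[OF F, of m] step_cauchyD(1)[OF G, of m]
          step_cauchyD(1)[OF F, of n] step_cauchyD(1)[OF G, of n], of c] N1[of m n] mn by simp
  qed
qed

lemma step_cauchy_const: "f \<in> V \<Longrightarrow> (\<lambda>n. f) \<in> CS"
  by (auto simp: nm_zero intro!: step_cauchyI)

lemma step_cauchy_scale: "F \<in> CS \<Longrightarrow> (\<lambda>n x. c * F n x) \<in> CS"
  using step_cauchy_lincomb[OF step_cauchy_const[OF zero_step], of F c] by simp

lemma step_rel_lincomb:
  assumes F: "(F, F') \<in> step_rel R T" and G: "(G, G') \<in> step_rel R T"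
  shows "((\<lambda>n x. F n x + c * G n x), (\<lambda>n x. F' n x + c * G' n x)) \<in> step_rel R T"
proof -
  have C: "F \<in> CS" "F' \<in> CS" "G \<in> CS" "G' \<in> CS" using F G by (auto simp: step_rel_iff)
  have "(\<lambda>n. nm (\<lambda>x. (F n x + c * G n x) - (F' n x + c * G' n x))) \<longlonglongrightarrow> 0"
  proof (rule null_squeeze)
    show "nm (\<lambda>x. (F n x + c * G n x) - (F' n x + c * G' n x))
        \<le> nm (\<lambda>x. F n x - F' n x) + \<bar>c\<bar> * nm (\<lambda>x. G n x - G' n x)" for n
      by (intro nm_diff_lincomb_le step_cauchyD(1) C)
    have "(\<lambda>n. nm (\<lambda>x. F n x - F' n x) + \<bar>c\<bar> * nm (\<lambda>x. G n x - G' n x)) \<longlonglongrightarrow> 0 + \<bar>c\<bar> * 0"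
      using F G by (intro tendsto_intros) (auto simp: step_rel_iff)
    then show "(\<lambda>n. nm (\<lambda>x. F n x - F' n x) + \<bar>c\<bar> * nm (\<lambda>x. G n x - G' n x)) \<longlonglongrightarrow> 0" by simp
  qed (intro step_space_diff step_space_lincomb(1) step_cauchyD(1) C)
  then show ?thesis using C by (simp add: step_rel_iff step_cauchy_lincomb)
qed

lemma add_integrand_class:
  assumes "F \<in> CS" "G \<in> CS"
  shows "integrand_add R T (integrand_class F) (integrand_class G) = integrand_class (\<lambda>n x. F n x + G n x)"
  using integrand_class_eqI[OF step_rel_lincomb[OF rep_integrand_class(1)[OF assms(1)] rep_integrand_class(1)[OF assms(2)], of 1]]
  by (simp add: integrand_add_def integrand_class_def[symmetric])

lemma scale_integrand_class:
  assumes "F \<in> CS"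
  shows "integrand_scale R T c (integrand_class F) = integrand_class (\<lambda>n x. c * F n x)"
  using integrand_class_eqI[OF step_rel_lincomb[OF step_rel_refl[OF step_cauchy_const[OF zero_step]]
        rep_integrand_class(1)[OF assms], of c]]
  by (simp add: integrand_scale_def integrand_class_def[symmetric])

text \<open>The inner product in the definition of the distance is evaluated at a chosen representative; a
  different representative changes the seminorms only by a null sequence.\<close>

lemma dist_integrand_class:
  assumes F: "F \<in> CS" and G: "G \<in> CS"
  shows "(\<lambda>n. nm (\<lambda>x. F n x - G n x)) \<longlonglongrightarrow> integrand_dist R T (integrand_class F) (integrand_class G)"
proof -
  define D where "D n x = F n x - G n x" for n x
  have D: "D \<in> CS" using step_cauchy_lincomb[OF F G, of "-1"] by (simp add: D_def[abs_def])
  define E where "E = integrand_rep (integrand_class D)"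
  have E: "E \<in> CS" and DE: "(\<lambda>n. nm (\<lambda>x. D n x - E n x)) \<longlonglongrightarrow> 0"
    using rep_integrand_class[OF D] by (auto simp: E_def step_rel_iff)
  obtain L where L: "(\<lambda>n. nm (E n)) \<longlonglongrightarrow> L"
    using cauchy_nm_convergent[OF E] by (auto simp: convergent_def)
  have "L \<ge> 0" using L nm_nonneg[OF step_cauchyD(1)[OF E]] by (intro LIMSEQ_le_const) auto
  have "(\<lambda>n. ip (E n) (E n)) \<longlonglongrightarrow> L\<^sup>2"
    using tendsto_power[OF L, of 2] by (simp add: nm_sq step_cauchyD(1)[OF E])
  then have "integrand_inner R (integrand_class D) (integrand_class D) = L\<^sup>2"
    unfolding integrand_inner_def E_def[symmetric] by (rule limI)
  moreover have "integrand_add R T (integrand_class F) (integrand_scale R T (-1) (integrand_class G)) = integrand_class D"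
    unfolding scale_integrand_class[OF G] add_integrand_class[OF F step_cauchy_scale[OF G]] by (simp add: D_def[abs_def])
  ultimately have dist: "integrand_dist R T (integrand_class F) (integrand_class G) = L"
    using \<open>L \<ge> 0\<close> by (simp add: integrand_dist_def Let_def)
  have "(\<lambda>n. nm (D n) - nm (E n)) \<longlonglongrightarrow> 0"
    by (rule Lim_null_comparison[OF always_eventually DE])
       (simp add: nm_diff_abs step_cauchyD(1)[OF D] step_cauchyD(1)[OF E])
  from tendsto_add[OF this L] show ?thesis unfolding dist by (simp add: D_def[abs_def])
qed

section \<open>Indefinite Wiener integrals and bounded truncation\<close>

definition step_cut_bounded :: "real \<Rightarrow> bool" where
  "step_cut_bounded r \<longleftrightarrow> (\<exists>C. \<forall>f\<in>V. nm (step_cut r f) \<le> C * nm f)"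

lemma integrand_of_integrand_class: "integrand_of R T f = integrand_class (\<lambda>n. f)"
  by (simp add: integrand_of_def integrand_class_def)

text \<open>Step functions are combinations of indicators, so linearity determines the operator on them.\<close>

lemma operator_on_steps:
  assumes lin: "continuous_linear_operator R T I"
    and ind: "\<And>t. t \<in> {0..T} \<Longrightarrow> I (integrand_class (\<lambda>n. indicator {0<..t})) = integrand_class (\<lambda>n. indicator {0<..min t r})"
    and r: "r \<in> {0..T}" and f: "f \<in> V"
  shows "I (integrand_class (\<lambda>n. f)) = integrand_class (\<lambda>n. step_cut r f)"
proof -
  have scale: "I (integrand_scale R T c A) = integrand_scale R T c (I A)" if "A \<in> integrands R T" for c A
    using lin that by (simp add: continuous_linear_operator_def)
  have add: "I (integrand_add R T A B) = integrand_add R T (I A) (I B)"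
    if "A \<in> integrands R T" "B \<in> integrands R T" for A B
    using lin that by (simp add: continuous_linear_operator_def)
  have const: "integrand_class (\<lambda>n. g) \<in> integrands R T" if "g \<in> V" for g
    using step_cauchy_const[OF that] by (auto simp: integrands_iff)
  show ?thesis
    using f
  proof (induction rule: step_space_induct)
    case zero
    \<comment> \<open>The zero class is \<open>0\<close> times any class, hence fixed by homogeneity.\<close>
    let ?z = "integrand_class (\<lambda>n x. 0)"
    have "I ?z \<in> integrands R T" using lin const[OF zero_step] by (auto simp: continuous_linear_operator_def)
    then obtain G where G: "G \<in> CS" "I ?z = integrand_class G" by (auto simp: integrands_iff)
    have "I ?z = integrand_scale R T 0 (I ?z)"
      using scale[OF const[OF zero_step], of 0] scale_integrand_class[OF step_cauchy_const[OF zero_step], of 0] by simp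
    also have "\<dots> = ?z" using scale_integrand_class[OF G(1), of 0] by (simp add: G(2))
    finally show ?case by (simp add: step_cut_def)
  next
    case (lincomb g c t)
    note i = indicator_step[OF lincomb(2)]
    have m: "min t r \<in> {0..T}" using lincomb(2) r by auto
    have split: "integrand_class (\<lambda>n x. f x + c * h x) = integrand_add R T (integrand_class (\<lambda>n. f)) (integrand_scale R T c (integrand_class (\<lambda>n. h)))"
      if "f \<in> V" "h \<in> V" for f h
      using that by (simp add: scale_integrand_class add_integrand_class step_cauchy_const step_cauchy_scale step_space_scale)
    have sc: "integrand_scale R T c (integrand_class (\<lambda>n. indicator {0<..t})) \<in> integrands R T"
      unfolding scale_integrand_class[OF step_cauchy_const[OF i]] by (rule const[OF step_space_scale[OF i]])
    show ?case
      unfolding step_cut_lincomb step_cut_indicator split[OF lincomb(1) i]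
        split[OF step_cut_in_step_space[OF lincomb(1) r] indicator_step[OF m]]
      by (simp only: add[OF const[OF lincomb(1)] sc] scale[OF const[OF i]] lincomb(3) ind[OF lincomb(2)])
  qed
qed

lemma dist_const: "f \<in> V \<Longrightarrow> g \<in> V \<Longrightarrow> integrand_dist R T (integrand_class (\<lambda>n. f)) (integrand_class (\<lambda>n. g)) = nm (\<lambda>x. f x - g x)"
  using LIMSEQ_unique[OF tendsto_const dist_integrand_class[OF step_cauchy_const step_cauchy_const]] by metis

text \<open>Continuity at zero with tolerance \<open>1\<close> gives a radius \<open>d\<close>, and rescaling turns it into the
  bound \<open>2 / d\<close>.\<close>

lemma operator_imp_step_cut_bounded:
  assumes lin: "continuous_linear_operator R T I"
    and ind: "\<And>t. t \<in> {0..T} \<Longrightarrow> I (integrand_class (\<lambda>n. indicator {0<..t})) = integrand_class (\<lambda>n. indicator {0<..min t r})"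
    and r: "r \<in> {0..T}"
  shows "step_cut_bounded r"
proof -
  have I: "I (integrand_class (\<lambda>n. f)) = integrand_class (\<lambda>n. step_cut r f)" if "f \<in> V" for f
    by (rule operator_on_steps[OF lin _ r that]) (rule ind)
  have const: "integrand_class (\<lambda>n. g) \<in> integrands R T" if "g \<in> V" for g
    using step_cauchy_const[OF that] by (auto simp: integrands_iff)
  have cont: "\<forall>A\<in>integrands R T. \<forall>e>0. \<exists>d>0. \<forall>B\<in>integrands R T.
        integrand_dist R T B A < d \<longrightarrow> integrand_dist R T (I B) (I A) < e"
    using lin by (simp add: continuous_linear_operator_def)
  obtain d where d: "d > 0" and cd: "\<And>B. B \<in> integrands R T \<Longrightarrow> integrand_dist R T B (integrand_class (\<lambda>n x. 0)) < d
      \<Longrightarrow> integrand_dist R T (I B) (I (integrand_class (\<lambda>n x. 0))) < 1"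
    using cont[rule_format, OF const[OF zero_step], of 1] by auto
  have cut0: "step_cut r (\<lambda>x. 0) = (\<lambda>x. 0)" by (simp add: step_cut_def)
  have small: "nm (step_cut r f) < 1" if "f \<in> V" "nm f < d" for f
    using cd[OF const[OF that(1)]] that
    unfolding I[OF that(1)] I[OF zero_step] cut0 dist_const[OF that(1) zero_step]
      dist_const[OF step_cut_in_step_space[OF that(1) r] zero_step] by simp
  have "nm (step_cut r f) \<le> 2 / d * nm f" if f: "f \<in> V" for f
  proof (rule ccontr)
    assume neg: "\<not> ?thesis"
    define a where "a = nm (step_cut r f)"
    have "0 \<le> 2 / d * nm f" using d nm_nonneg[OF f] by simp
    then have a: "a > 0" using neg by (simp add: a_def)
    have "step_cut r (\<lambda>x. 1 / a * f x) = (\<lambda>x. 1 / a * step_cut r f x)" by (auto simp: step_cut_def)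
    then have 1: "nm (step_cut r (\<lambda>x. 1 / a * f x)) = 1"
      using nm_scale[OF step_cut_in_step_space[OF f r], of "1 / a"] a by (simp add: a_def)
    have "nm (\<lambda>x. 1 / a * f x) = nm f / a" using nm_scale[OF f, of "1 / a"] a by simp
    also have "\<dots> < d"
    proof -
      have "2 * nm f < d * a" using neg d by (simp add: a_def field_simps)
      then have "nm f < d * a" using nm_nonneg[OF f] by simp
      then show ?thesis using a by (simp add: field_simps)
    qed
    finally show False using small[OF step_space_scale[OF f]] 1 by (metis less_irrefl)
  qed
  then show ?thesis unfolding step_cut_bounded_def by blast
qed

text \<open>The operator truncates the members of a representing sequence. By boundedness, Cauchy and null
  sequences are preserved, so the class of the result is independent of the representative.\<close>

lemma step_cut_bounded_imp_operator:
  assumes "step_cut_bounded r" and r: "r \<in> {0..T}"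
  obtains I where "continuous_linear_operator R T I"
    "\<And>t. t \<in> {0..T} \<Longrightarrow> I (integrand_class (\<lambda>n. indicator {0<..t})) = integrand_class (\<lambda>n. indicator {0<..min t r})"
proof -
  obtain C0 where C0: "\<And>f. f \<in> V \<Longrightarrow> nm (step_cut r f) \<le> C0 * nm f"
    using assms(1) by (auto simp: step_cut_bounded_def)
  define C where "C = \<bar>C0\<bar> + 1"
  have Cpos: "C > 0" by (simp add: C_def)
  have C: "nm (step_cut r f) \<le> C * nm f" if "f \<in> V" for f
  proof -
    have "C0 * nm f \<le> C * nm f" using nm_nonneg[OF that] by (intro mult_right_mono) (auto simp: C_def)
    then show ?thesis using C0[OF that] by simp
  qed
  have Cdiff: "nm (\<lambda>x. step_cut r f x - step_cut r g x) \<le> C * nm (\<lambda>x. f x - g x)" if "f \<in> V" "g \<in> V" for f g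
    using C[OF step_space_diff[OF that]] by (simp add: step_cut_diff)
  have cutC: "(\<lambda>n. step_cut r (F n)) \<in> CS" if F: "F \<in> CS" for F
  proof (rule step_cauchyI)
    show "step_cut r (F n) \<in> V" for n by (rule step_cut_in_step_space[OF step_cauchyD(1)[OF F] r])
    fix e :: real assume "e > 0"
    then obtain N where N: "\<And>m n. m \<ge> N \<Longrightarrow> n \<ge> N \<Longrightarrow> nm (\<lambda>x. F m x - F n x) < e / C"
      using step_cauchyD(2)[OF F, of "e / C"] Cpos by auto
    show "\<exists>N. \<forall>m\<ge>N. \<forall>n\<ge>N. nm (\<lambda>x. step_cut r (F m) x - step_cut r (F n) x) < e"
    proof (intro exI allI impI)
      fix m n assume "m \<ge> N" "n \<ge> N"
      then have "C * nm (\<lambda>x. F m x - F n x) < e"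
        using N[of m n] Cpos by (simp add: pos_less_divide_eq mult.commute)
      then show "nm (\<lambda>x. step_cut r (F m) x - step_cut r (F n) x) < e"
        using Cdiff[OF step_cauchyD(1)[OF F] step_cauchyD(1)[OF F], of m n] by simp
    qed
  qed
  have cut_rel: "((\<lambda>n. step_cut r (F n)), (\<lambda>n. step_cut r (G n))) \<in> step_rel R T"
    if "(F, G) \<in> step_rel R T" for F G
  proof -
    have FG: "F \<in> CS" "G \<in> CS" and lim: "(\<lambda>n. nm (\<lambda>x. F n x - G n x)) \<longlonglongrightarrow> 0"
      using that by (auto simp: step_rel_iff)
    have "(\<lambda>n. nm (\<lambda>x. step_cut r (F n) x - step_cut r (G n) x)) \<longlonglongrightarrow> 0"
    proof (rule null_squeeze)
      show "nm (\<lambda>x. step_cut r (F n) x - step_cut r (G n) x) \<le> C * nm (\<lambda>x. F n x - G n x)" for n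
        by (intro Cdiff step_cauchyD(1) FG)
    qed (intro step_space_diff step_cut_in_step_space step_cauchyD(1) FG r tendsto_mult_right_zero lim)+
    then show ?thesis using FG cutC by (simp add: step_rel_iff)
  qed
  define I where "I A = integrand_class (\<lambda>n. step_cut r (integrand_rep A n))" for A
  have I: "I (integrand_class F) = integrand_class (\<lambda>n. step_cut r (F n))" if "F \<in> CS" for F
    unfolding I_def by (rule integrand_class_eqI[OF step_rel_sym[OF cut_rel[OF rep_integrand_class(1)[OF that]]]])
  have dist: "integrand_dist R T (I (integrand_class F)) (I (integrand_class G)) \<le> C * integrand_dist R T (integrand_class F) (integrand_class G)"
    if "F \<in> CS" "G \<in> CS" for F G
    unfolding I[OF that(1)] I[OF that(2)]
    by (rule LIMSEQ_le[OF dist_integrand_class[OF cutC cutC] tendsto_mult_left[OF dist_integrand_class]])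
       (use that Cdiff step_cauchyD(1) in auto)
  have cut_add: "step_cut r (\<lambda>x. f x + g x) = (\<lambda>x. step_cut r f x + step_cut r g x)"
    and cut_scale: "step_cut r (\<lambda>x. c * f x) = (\<lambda>x. c * step_cut r f x)" for f g c
    by (auto simp: step_cut_def)
  have addC: "(\<lambda>n x. F n x + G n x) \<in> CS" if "F \<in> CS" "G \<in> CS" for F G
    using step_cauchy_lincomb[OF that, of 1] by simp
  have "continuous_linear_operator R T I"
    unfolding continuous_linear_operator_def
  proof (intro conjI ballI allI impI)
    show "I \<in> integrands R T \<rightarrow> integrands R T"
    proof
      fix A assume "A \<in> integrands R T"
      then obtain F where "F \<in> CS" "A = integrand_class F" by (auto simp: integrands_iff)
      then show "I A \<in> integrands R T" unfolding integrands_iff using I cutC by blast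
    qed
  next
    fix A B assume "A \<in> integrands R T" "B \<in> integrands R T"
    then show "I (integrand_add R T A B) = integrand_add R T (I A) (I B)"
      by (auto simp: integrands_iff add_integrand_class I cutC addC cut_add)
  next
    fix c A assume "A \<in> integrands R T"
    then show "I (integrand_scale R T c A) = integrand_scale R T c (I A)"
      by (auto simp: integrands_iff scale_integrand_class I cutC step_cauchy_scale cut_scale)
  next
    fix A and e :: real assume A: "A \<in> integrands R T" and e: "e > 0"
    show "\<exists>d>0. \<forall>B\<in>integrands R T. integrand_dist R T B A < d \<longrightarrow> integrand_dist R T (I B) (I A) < e"
    proof (intro exI[of _ "e / C"] conjI ballI impI)
      show "e / C > 0" using e Cpos by simp
      fix B assume B: "B \<in> integrands R T" and less: "integrand_dist R T B A < e / C"
      have "integrand_dist R T (I B) (I A) \<le> C * integrand_dist R T B A"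
        using A B dist by (auto simp: integrands_iff)
      also have "\<dots> < e" using less Cpos by (simp add: pos_less_divide_eq mult.commute)
      finally show "integrand_dist R T (I B) (I A) < e" .
    qed
  qed
  moreover have "I (integrand_class (\<lambda>n. indicator {0<..t})) = integrand_class (\<lambda>n. indicator {0<..min t r})"
    if "t \<in> {0..T}" for t
    using I[OF step_cauchy_const[OF indicator_step[OF that]]] by (simp only: step_cut_indicator)
  ultimately show ?thesis using that by blast
qed

lemma wiener_integral_iff: "has_indefinite_wiener_integral M T X \<longleftrightarrow> (\<forall>r\<in>{0..T}. step_cut_bounded r)"
  unfolding has_indefinite_wiener_integral_def integrand_of_integrand_class
  by (metis operator_imp_step_cut_bounded step_cut_bounded_imp_operator)

section \<open>Cameron-Martin functions and bounded truncation\<close>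

text \<open>Closedness under truncation provides for each Cauchy sequence \<open>F\<close> a Cauchy sequence \<open>G\<close> with
  \<open>lim \<langle>f, G\<^sub>n\<rangle> = lim \<langle>step_cut r f, F\<^sub>n\<rangle>\<close>, at first for indicators and then for all step
  functions. So \<open>G\<close> is the adjoint of truncation applied to \<open>F\<close>, and the seminorms of \<open>G\<close> bound the
  functional: truncation is weakly bounded.\<close>

lemma truncation_imp_step_cut_bounded:
  assumes cl: "closed_under_truncation M T X" and r: "r \<in> {0..T}"
  shows "step_cut_bounded r"
  unfolding step_cut_bounded_def
proof (rule uniform_boundedness)
  show "step_cut r f \<in> V" if "f \<in> V" for f by (rule step_cut_in_step_space[OF that r])
  fix F assume F: "F \<in> CS"
  define u where "u = restrict (\<lambda>t. lim (\<lambda>n. ip (indicator {0<..t}) (F n))) {0..T}"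
  have u: "(\<lambda>n. ip (indicator {0<..t}) (F n)) \<longlonglongrightarrow> u t" if "t \<in> {0..T}" for t
    using cauchy_ip_convergent[OF F indicator_step[OF that]] that
    by (simp add: u_def convergent_LIMSEQ_iff)
  have "u \<in> cameron_martin M T X"
    unfolding cameron_martin_iff using u F restrict_extensional[of _ "{0..T}"] unfolding u_def by metis
  then have "truncate_at T r u \<in> cameron_martin M T X"
    using cl r by (simp add: closed_under_truncation_def)
  then obtain G where G: "G \<in> CS" and Gt: "\<And>t. t \<in> {0..T} \<Longrightarrow>
      (\<lambda>n. ip (indicator {0<..t}) (G n)) \<longlonglongrightarrow> truncate_at T r u t"
    unfolding cameron_martin_iff by blast
  have adj: "(\<lambda>n. ip f (G n) - ip (step_cut r f) (F n)) \<longlonglongrightarrow> 0" if "f \<in> V" for f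
    using that
  proof (induction rule: step_space_induct)
    case zero
    have "ip (\<lambda>x. 0) h = 0" if "h \<in> V" for h
      using ip_zero[OF that] step_inner_commute[OF that zero_step] by simp
    then show ?case using step_cauchyD(1)[OF F] step_cauchyD(1)[OF G] by (simp add: step_cut_def)
  next
    case (lincomb g c t)
    have m: "min t r \<in> {0..T}" using lincomb(2) r by auto
    have "(\<lambda>n. ip (indicator {0<..t}) (G n) - ip (indicator {0<..min t r}) (F n))
        \<longlonglongrightarrow> truncate_at T r u t - u (min t r)"
      by (rule tendsto_diff[OF Gt[OF lincomb(2)] u[OF m]])
    also have "truncate_at T r u t - u (min t r) = 0" using lincomb(2) by (simp add: truncate_at_def)
    finally have "(\<lambda>n. (ip g (G n) - ip (step_cut r g) (F n)) +
        c * (ip (indicator {0<..t}) (G n) - ip (indicator {0<..min t r}) (F n))) \<longlonglongrightarrow> 0 + c * 0"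
      by (intro tendsto_add tendsto_mult_left lincomb(3))
    moreover have "ip (\<lambda>x. g x + c * indicator {0<..t} x) (G n)
        - ip (step_cut r (\<lambda>x. g x + c * indicator {0<..t} x)) (F n)
      = (ip g (G n) - ip (step_cut r g) (F n)) +
        c * (ip (indicator {0<..t}) (G n) - ip (indicator {0<..min t r}) (F n))" for n
      unfolding step_cut_lincomb step_cut_indicator
        ip_lincomb_left[OF lincomb(1) indicator_step[OF lincomb(2)] step_cauchyD(1)[OF G]]
        ip_lincomb_left[OF step_cut_in_step_space[OF lincomb(1) r] indicator_step[OF m] step_cauchyD(1)[OF F]]
      by (simp add: algebra_simps)
    ultimately show ?case by simp
  qed
  obtain K where K: "\<And>n. nm (G n) \<le> K" using cauchy_bounded[OF G] by blast
  have "\<bar>l\<bar> \<le> K * nm f" if f: "f \<in> V" and l: "(\<lambda>n. ip (step_cut r f) (F n)) \<longlonglongrightarrow> l" for f l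
  proof -
    have "(\<lambda>n. ip f (G n)) \<longlonglongrightarrow> l" using tendsto_add[OF adj[OF f] l] by simp
    moreover have "\<bar>ip f (G n)\<bar> \<le> K * nm f" for n
    proof -
      have "\<bar>ip f (G n)\<bar> \<le> nm f * nm (G n)" by (rule step_Cauchy_Schwarz[OF f step_cauchyD(1)[OF G]])
      also have "\<dots> \<le> nm f * K" by (rule mult_left_mono[OF K nm_nonneg[OF f]])
      finally show ?thesis by (simp add: mult.commute)
    qed
    ultimately show ?thesis by (intro LIMSEQ_le_const2[OF tendsto_rabs]) auto
  qed
  then show "\<exists>K. \<forall>f\<in>V. \<forall>l. (\<lambda>n. ip (step_cut r f) (F n)) \<longlonglongrightarrow> l \<longrightarrow> \<bar>l\<bar> \<le> K * nm f" by blast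
qed

text \<open>The functional \<open>f \<mapsto> lim \<langle>step_cut r f, F\<^sub>n\<rangle>\<close> takes the value of the truncated function at
  \<open>t\<close> on the indicator of \<open>(0,t]\<close>. A bound for truncation makes it continuous, and its representing
  sequence exhibits the truncated function as a Cameron-Martin function.\<close>

lemma step_cut_bounded_imp_truncation:
  assumes bd: "step_cut_bounded r" and r: "r \<in> {0..T}" and u: "u \<in> cameron_martin M T X"
  shows "truncate_at T r u \<in> cameron_martin M T X"
proof -
  obtain C where C: "\<And>f. f \<in> V \<Longrightarrow> nm (step_cut r f) \<le> C * nm f" using bd by (auto simp: step_cut_bounded_def)
  obtain F where F: "F \<in> CS" and Fu: "\<And>t. t \<in> {0..T} \<Longrightarrow> (\<lambda>n. ip (indicator {0<..t}) (F n)) \<longlonglongrightarrow> u t"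
    using u unfolding cameron_martin_iff by blast
  obtain K where K: "\<And>n. nm (F n) \<le> K" using cauchy_bounded[OF F] by blast
  define \<phi> where "\<phi> f = lim (\<lambda>n. ip (step_cut r f) (F n))" for f
  have \<phi>: "(\<lambda>n. ip (step_cut r f) (F n)) \<longlonglongrightarrow> \<phi> f" if "f \<in> V" for f
    using cauchy_ip_convergent[OF F step_cut_in_step_space[OF that r]] by (simp add: \<phi>_def convergent_LIMSEQ_iff)
  have "\<exists>G\<in>CS. \<forall>f\<in>V. (\<lambda>n. ip f (G n)) \<longlonglongrightarrow> \<phi> f"
  proof (rule riesz_representation)
    fix f g c assume fg: "f \<in> V" "g \<in> V"
    have "(\<lambda>n. ip (step_cut r f) (F n) + c * ip (step_cut r g) (F n)) \<longlonglongrightarrow> \<phi> f + c * \<phi> g"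
      by (intro tendsto_intros \<phi> fg)
    then have "(\<lambda>n. ip (step_cut r (\<lambda>x. f x + c * g x)) (F n)) \<longlonglongrightarrow> \<phi> f + c * \<phi> g"
      unfolding step_cut_lincomb
        ip_lincomb_left[OF step_cut_in_step_space[OF fg(1) r] step_cut_in_step_space[OF fg(2) r] step_cauchyD(1)[OF F]] .
    then show "\<phi> (\<lambda>x. f x + c * g x) = \<phi> f + c * \<phi> g"
      by (rule LIMSEQ_unique[OF \<phi>[OF step_space_lincomb(1)[OF fg]]])
  next
    fix f assume f: "f \<in> V"
    have "\<bar>ip (step_cut r f) (F n)\<bar> \<le> C * K * nm f" for n
    proof -
      have "\<bar>ip (step_cut r f) (F n)\<bar> \<le> nm (step_cut r f) * nm (F n)"
        by (rule step_Cauchy_Schwarz[OF step_cut_in_step_space[OF f r] step_cauchyD(1)[OF F]])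
      also have "\<dots> \<le> (C * nm f) * K"
        using C[OF f] K nm_nonneg[OF step_cut_in_step_space[OF f r]] nm_nonneg[OF step_cauchyD(1)[OF F]]
        by (intro mult_mono) (auto intro: order_trans)
      finally show ?thesis by (simp add: mult_ac)
    qed
    then show "\<bar>\<phi> f\<bar> \<le> C * K * nm f" by (intro LIMSEQ_le_const2[OF tendsto_rabs[OF \<phi>[OF f]]]) auto
  qed
  then obtain G where G: "G \<in> CS" "\<And>f. f \<in> V \<Longrightarrow> (\<lambda>n. ip f (G n)) \<longlonglongrightarrow> \<phi> f" by blast
  have "\<phi> (indicator {0<..t}) = truncate_at T r u t" if t: "t \<in> {0..T}" for t
  proof -
    have m: "min t r \<in> {0..T}" using t r by auto
    show ?thesis
      using LIMSEQ_unique[OF \<phi>[OF indicator_step[OF t], unfolded step_cut_indicator] Fu[OF m]] t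
      by (simp add: truncate_at_def)
  qed
  then have "\<forall>t\<in>{0..T}. (\<lambda>n. ip (indicator {0<..t}) (G n)) \<longlonglongrightarrow> truncate_at T r u t"
    using G(2)[OF indicator_step] by metis
  moreover have "truncate_at T r u \<in> extensional {0..T}" by (simp add: truncate_at_def)
  ultimately show ?thesis unfolding cameron_martin_iff using G(1) by blast
qed

lemma truncation_iff: "closed_under_truncation M T X \<longleftrightarrow> (\<forall>r\<in>{0..T}. step_cut_bounded r)"
  using truncation_imp_step_cut_bounded step_cut_bounded_imp_truncation
  by (auto simp: closed_under_truncation_def)

end

theorem theorem5p1:
  fixes M :: "'a measure" and T :: real and X :: "real \<Rightarrow> 'a \<Rightarrow> real"
  assumes "centered_gaussian_process M T X"
  shows "has_indefinite_wiener_integral M T X \<longleftrightarrow> closed_under_truncation M T X"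
proof -
  interpret centered_gaussian_process M T X by fact
  show ?thesis by (simp only: wiener_integral_iff truncation_iff)
qed

end
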